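(* Let $r\geq3$, let $\mathbf{K}$ be the random $K_r$-free graph (the Fraïssé limit of the class of finite graphs with no clique of size $r$) and $G=\mathrm{Aut}(\mathbf{K})$. Let $\mathbf{A}_2\subseteq\mathbf{K}$ be a substructure consisting of two vertices joined by an edge, and $H_2=\mathrm{Emb}(\mathbf{A}_2,\mathbf{K})$. Suppose $T\subseteq H_2$ is such that the $G$-orbit of $\chi_T$ is dense in $2^{H_2}$. Then for every finite substructure $\mathbf{A}_n$ of $\mathbf{K}$ with $\mathbf{A}_2\subseteq\mathbf{A}_n$, the set $\{s\in\mathrm{Emb}(\mathbf{A}_n,\mathbf{K}):s|_{\mathbf{A}_2}\in T\}$ does not belong to the Boolean algebra of subsets of $\mathrm{Emb}(\mathbf{A}_n,\mathbf{K})$ generated by the minimal subsets of $\mathrm{Emb}(\mathbf{A}_n,\mathbf{K})$ (i.e. $T\notin B'_2$).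
   Context: For a finite substructure $\mathbf{A}\subseteq\mathbf{K}$, identify subsets of $H=\mathrm{Emb}(\mathbf{A},\mathbf{K})$ with $2^{H}$ (product topology), with right $G$-action $(\chi\cdot g)(f)=\chi(g\circ f)$. A set $S\subseteq H$ is minimal if the orbit closure $\overline{\chi_S\cdot G}\subseteq 2^H$ is a minimal $G$-flow (every orbit dense). *)

theory Defs
  imports "HOL-Analysis.Analysis"
begin

definition is_graph :: "'v set \<Rightarrow> ('v \<Rightarrow> 'v \<Rightarrow> bool) \<Rightarrow> bool" where
  "is_graph V E \<longleftrightarrow> (\<forall>x y. E x y \<longrightarrow> x \<in> V \<and> y \<in> V \<and> x \<noteq> y \<and> E y x)"

definition has_clique :: "'v set \<Rightarrow> ('v \<Rightarrow> 'v \<Rightarrow> bool) \<Rightarrow> nat \<Rightarrow> bool" where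
  "has_clique V E r \<longleftrightarrow> (\<exists>C. C \<subseteq> V \<and> finite C \<and> card C = r \<and>
       (\<forall>x\<in>C. \<forall>y\<in>C. x \<noteq> y \<longrightarrow> E x y))"

definition graph_embeds :: "'w set \<Rightarrow> ('w \<Rightarrow> 'w \<Rightarrow> bool) \<Rightarrow> 'v set \<Rightarrow> ('v \<Rightarrow> 'v \<Rightarrow> bool) \<Rightarrow> bool" where
  "graph_embeds W R V E \<longleftrightarrow> (\<exists>f. f ` W \<subseteq> V \<and> inj_on f W \<and>
       (\<forall>x\<in>W. \<forall>y\<in>W. E (f x) (f y) \<longleftrightarrow> R x y))"

definition Aut :: "'v set \<Rightarrow> ('v \<Rightarrow> 'v \<Rightarrow> bool) \<Rightarrow> ('v \<Rightarrow> 'v) set" where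
  "Aut V E = {g. bij_betw g V V \<and> (\<forall>x\<in>V. \<forall>y\<in>V. E (g x) (g y) \<longleftrightarrow> E x y)}"

definition ultrahomogeneous :: "'v set \<Rightarrow> ('v \<Rightarrow> 'v \<Rightarrow> bool) \<Rightarrow> bool" where
  "ultrahomogeneous V E \<longleftrightarrow> (\<forall>A B h. finite A \<and> A \<subseteq> V \<and> B \<subseteq> V \<and> bij_betw h A B \<and>
       (\<forall>x\<in>A. \<forall>y\<in>A. E (h x) (h y) \<longleftrightarrow> E x y) \<longrightarrow>
       (\<exists>g\<in>Aut V E. \<forall>x\<in>A. g x = h x))"

text \<open>(V,E) is the Fraisse limit of the class of finite K_r-free graphs: a countable
  ultrahomogeneous graph whose age is exactly the class of finite K_r-free graphs
  (every finite graph is isomorphic to one on a finite set of naturals).\<close>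
definition random_Kr_free_graph :: "nat \<Rightarrow> 'v set \<Rightarrow> ('v \<Rightarrow> 'v \<Rightarrow> bool) \<Rightarrow> bool" where
  "random_Kr_free_graph r V E \<longleftrightarrow>
     is_graph V E \<and> countable V \<and> ultrahomogeneous V E \<and>
     (\<forall>A. finite A \<and> A \<subseteq> V \<longrightarrow> \<not> has_clique A E r) \<and>
     (\<forall>(W::nat set) R. finite W \<and> is_graph W R \<and> \<not> has_clique W R r \<longrightarrow> graph_embeds W R V E)"

definition Emb :: "'v set \<Rightarrow> 'v set \<Rightarrow> ('v \<Rightarrow> 'v \<Rightarrow> bool) \<Rightarrow> ('v \<Rightarrow> 'v) set" where
  "Emb A V E = {f. f ` A \<subseteq> V \<and> inj_on f A \<and> (\<forall>x\<in>A. \<forall>y\<in>A. E (f x) (f y) \<longleftrightarrow> E x y) \<and>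
       (\<forall>x. x \<notin> A \<longrightarrow> f x = undefined)}"

definition emb_act :: "'v set \<Rightarrow> ('v \<Rightarrow> 'v) \<Rightarrow> ('v \<Rightarrow> 'v) \<Rightarrow> ('v \<Rightarrow> 'v)" where
  "emb_act A g f = restrict (g \<circ> f) A"

definition cantor_top :: "('v \<Rightarrow> 'v) set \<Rightarrow> (('v \<Rightarrow> 'v) \<Rightarrow> bool) topology" where
  "cantor_top H = product_topology (\<lambda>_. discrete_topology (UNIV :: bool set)) H"

definition char_set :: "('v \<Rightarrow> 'v) set \<Rightarrow> ('v \<Rightarrow> 'v) set \<Rightarrow> (('v \<Rightarrow> 'v) \<Rightarrow> bool)" where
  "char_set H S = restrict (\<lambda>f. f \<in> S) H"

definition flow_act :: "'v set \<Rightarrow> ('v \<Rightarrow> 'v) set \<Rightarrow> (('v \<Rightarrow> 'v) \<Rightarrow> bool) \<Rightarrow> ('v \<Rightarrow> 'v) \<Rightarrow> (('v \<Rightarrow> 'v) \<Rightarrow> bool)" where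
  "flow_act A H c g = restrict (\<lambda>f. c (emb_act A g f)) H"

definition orbit :: "'v set \<Rightarrow> 'v set \<Rightarrow> ('v \<Rightarrow> 'v \<Rightarrow> bool) \<Rightarrow> (('v \<Rightarrow> 'v) \<Rightarrow> bool) \<Rightarrow> (('v \<Rightarrow> 'v) \<Rightarrow> bool) set" where
  "orbit A V E c = {flow_act A (Emb A V E) c g | g. g \<in> Aut V E}"

definition orbit_closure :: "'v set \<Rightarrow> 'v set \<Rightarrow> ('v \<Rightarrow> 'v \<Rightarrow> bool) \<Rightarrow> (('v \<Rightarrow> 'v) \<Rightarrow> bool) \<Rightarrow> (('v \<Rightarrow> 'v) \<Rightarrow> bool) set" where
  "orbit_closure A V E c = cantor_top (Emb A V E) closure_of orbit A V E c"

text \<open>S \<subseteq> H is minimal if the orbit closure of chi_S is a minimal G-flow (every orbit in it dense).\<close>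
definition minimal_subset :: "'v set \<Rightarrow> 'v set \<Rightarrow> ('v \<Rightarrow> 'v \<Rightarrow> bool) \<Rightarrow> ('v \<Rightarrow> 'v) set \<Rightarrow> bool" where
  "minimal_subset A V E S \<longleftrightarrow> S \<subseteq> Emb A V E \<and>
     (\<forall>c\<in>orbit_closure A V E (char_set (Emb A V E) S).
        orbit_closure A V E c = orbit_closure A V E (char_set (Emb A V E) S))"

inductive_set gen_bool_alg :: "'a set \<Rightarrow> 'a set set \<Rightarrow> 'a set set" for H M where
  gen: "S \<in> M \<Longrightarrow> S \<in> gen_bool_alg H M"
| top: "H \<in> gen_bool_alg H M"
| compl: "S \<in> gen_bool_alg H M \<Longrightarrow> H - S \<in> gen_bool_alg H M"
| union: "S \<in> gen_bool_alg H M \<Longrightarrow> T \<in> gen_bool_alg H M \<Longrightarrow> S \<union> T \<in> gen_bool_alg H M"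

end

theory Submission
  imports Defs "HOL-Library.Ramsey"
begin

text \<open>A minimal subset of \<open>Emb(A, K)\<close> is determined by linear orders: by the ordered Ramsey property of
  finite \<open>K\<^sub>r\<close>-free graphs (Nesetril--Roedl) and compactness, on every finite \<open>F \<subseteq> K\<close> there is a linear
  order such that membership of \<open>f\<close> depends only on the order it induces on \<open>A\<close>. Hence \<open>k\<close> minimal
  sets leave only \<open>2\<close> to the \<open>O(k N log N)\<close> traces on a set of \<open>N\<close> vertices. A set with dense orbit
  realises all \<open>2\<close> to the \<open>n\<^sup>2\<close> patterns on the lifts of the edge \<open>ab\<close> to a blow-up with \<open>n\<close>
  copies of each vertex, which is impossible for large \<open>n\<close>.

  The Ramsey property comes from the partite construction, with Hales--Jewett as partite lemma. It
  is run twice: over a complete graph on \<open>{..<p}\<close>, followed by Ramsey's theorem for hypergraphs, it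
  gives a graph \<open>G\<close> that may contain large cliques; over \<open>G\<close> as base, only edges of \<open>A\<close> lie
  below edges, so the partite lemma maps homomorphically to its input and creates no new clique.\<close>

section \<open>The Hales--Jewett theorem\<close>

text \<open>Each run of the partite construction only makes the colour of a copy of \<open>A\<close>
  depend on its projection to the base. This dependence is itself a colouring of copies in the base,
  so a Ramsey property of the base is inherited; that is how the two runs compose. One run over the
  complete base would not control cliques: non-edges of \<open>A\<close> then lie below base edges,
  where one adjacent coordinate suffices, and a clique of the power could use different coordinates
  for different pairs. No order on all of the random graph is constructed. Each finite set may have
  its own order, with no coherence between them, because the final count looks at one finite set
  only. The patterns to be counted occur on translates of the blow-up by automorphisms that depend
  on the pattern; order-determinacy on all finite sets lets every one of them be pulled back to the
  same blow-up and be coded there.\<close>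

definition word_subst :: "nat option list \<Rightarrow> nat \<Rightarrow> nat list" where
  "word_subst l x = map (\<lambda>p. case p of None \<Rightarrow> x | Some y \<Rightarrow> y) l"

definition line_words :: "nat \<Rightarrow> nat \<Rightarrow> nat option list set" where
  "line_words L N = {l. length l = N \<and> None \<in> set l \<and> set l \<subseteq> insert None (Some ` {..<L})}"

lemma length_word_subst [simp]: "length (word_subst l x) = length l"
  by (simp add: word_subst_def)

lemma set_word_subst: "l \<in> line_words L N \<Longrightarrow> x < L \<Longrightarrow> set (word_subst l x) \<subseteq> {..<L}"
  by (force simp: word_subst_def line_words_def split: option.splits)

lemma finite_line_words [simp]: "finite (line_words L N)"
proof (rule finite_subset)
  show "line_words L N \<subseteq> {l. set l \<subseteq> insert None (Some ` {..<L}) \<and> length l = N}"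
    by (auto simp: line_words_def)
qed (simp add: finite_lists_length_eq)

text \<open>A combinatorial subspace of dimension \<open>length ps\<close>, parametrised by words
  \<open>xs\<close>: every block of coordinates has its own variable.\<close>

definition subspace_word :: "nat option list list \<Rightarrow> nat list \<Rightarrow> nat list" where
  "subspace_word ps xs = concat (map2 word_subst ps xs)"

lemma length_subspace_word:
  "length xs = length ps \<Longrightarrow> length (subspace_word ps xs) = length (concat ps)"
  by (induction ps xs rule: list_induct2') (auto simp: subspace_word_def)

lemma subspace_word_snoc:
  "length xs = length ps \<Longrightarrow>
     subspace_word (ps @ [p]) (xs @ [x]) = subspace_word ps xs @ word_subst p x"
  by (simp add: subspace_word_def)

lemma set_subspace_word:
  assumes "\<forall>p\<in>set ps. None \<in> set p \<and> set p \<subseteq> insert None (Some ` {..<L})" "set xs \<subseteq> {..<L}"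
  shows "set (subspace_word ps xs) \<subseteq> {..<L}"
  using assms
proof (induction ps xs rule: list_induct2')
  case (4 p ps x xs)
  have "p \<in> line_words L (length p)" "x < L"
    using 4 by (auto simp: line_words_def)
  then show ?case
    using 4 set_word_subst[of p L "length p" x] by (auto simp: subspace_word_def)
qed (auto simp: subspace_word_def)

definition collapse_letter :: "nat \<Rightarrow> nat \<Rightarrow> nat" where
  "collapse_letter t x = (if x = t then 0 else x)"

text \<open>The first step of Shelah's proof: blocks are chosen from the last one backwards, each by a
  pigeonhole over the words \<open>t\<dots>t0\<dots>0\<close>.\<close>

lemma insensitive_subspace:
  fixes t n :: nat
  assumes "finite (R :: nat set)" "t \<ge> 1"
  shows "\<exists>N. \<forall>c. (\<forall>w. c w \<in> R) \<longrightarrow>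
    (\<exists>ps. length ps = n \<and> length (concat ps) = N \<and>
       (\<forall>p\<in>set ps. None \<in> set p \<and> set p \<subseteq> insert None (Some ` {..<Suc t})) \<and>
       (\<forall>xs. length xs = n \<and> set xs \<subseteq> {..<Suc t} \<longrightarrow>
          c (subspace_word ps xs) = c (subspace_word ps (map (collapse_letter t) xs))))"
  using assms(1)
proof (induction n arbitrary: R)
  case 0
  show ?case by (intro exI[of _ 0]) auto
next
  case (Suc n)
  \<comment> \<open>The first \<open>n\<close> blocks will be coloured by the whole list of colours
    that arise as the last block runs through its letters. Encoding the list as a number keeps the
    induction hypothesis applicable.\<close>
  define R' where "R' = list_encode ` {l. set l \<subseteq> R \<and> length l = Suc t}"
  have "finite R'"
    unfolding R'_def using Suc.prems by (intro finite_imageI finite_lists_length_eq)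
  from Suc.IH[OF this] obtain N where N: "\<And>c. (\<forall>w. c w \<in> R') \<Longrightarrow>
    (\<exists>ps. length ps = n \<and> length (concat ps) = N \<and>
       (\<forall>p\<in>set ps. None \<in> set p \<and> set p \<subseteq> insert None (Some ` {..<Suc t})) \<and>
       (\<forall>xs. length xs = n \<and> set xs \<subseteq> {..<Suc t} \<longrightarrow>
          c (subspace_word ps xs) = c (subspace_word ps (map (collapse_letter t) xs))))"
    by blast
  define W where "W = {w. set w \<subseteq> {..<Suc t} \<and> length w = N}"
  have finW: "finite W" unfolding W_def by (intro finite_lists_length_eq) simp
  \<comment> \<open>A last block of length \<open>m\<close> offers \<open>m + 1\<close> words
    \<open>Q j\<close>, one more than there are colourings of \<open>W\<close>.\<close>
  define m where "m = card (W \<rightarrow>\<^sub>E R)"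
  show ?case
  proof (intro exI[of _ "N + m"] allI impI)
    fix c :: "nat list \<Rightarrow> nat" assume c: "\<forall>w. c w \<in> R"
    define Q where "Q j = replicate j t @ replicate (m - j) 0" for j
    define col where "col j = restrict (\<lambda>w. c (w @ Q j)) W" for j
    have "\<not> inj_on col {..m}"
    proof
      assume inj: "inj_on col {..m}"
      have "col ` {..m} \<subseteq> W \<rightarrow>\<^sub>E R" using c by (auto simp: col_def)
      moreover have "finite (W \<rightarrow>\<^sub>E R)" using finW Suc.prems by (intro finite_PiE) auto
      ultimately have "card {..m} \<le> m" using inj card_inj_on_le unfolding m_def by blast
      then show False by simp
    qed
    then obtain j j' where j: "j < j'" "j' \<le> m" "col j = col j'"
      unfolding inj_on_def by (metis atMost_iff linorder_neqE_nat)
    \<comment> \<open>The variable occupies exactly the places where \<open>Q j\<close> and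
      \<open>Q j'\<close> differ, so the letters 0 and \<open>t\<close> give back these two
      words.\<close>
    define p where "p = replicate j (Some t) @ replicate (j' - j) None @ replicate (m - j') (Some 0)"
    have p_len: "length p = m" and p_None: "None \<in> set p"
      and p_letters: "set p \<subseteq> insert None (Some ` {..<Suc t})"
      using j by (auto simp: p_def)
    have "word_subst p t = Q j'"
      using j by (simp add: word_subst_def p_def Q_def flip: replicate_add append_assoc)
    moreover have "word_subst p 0 = Q j"
      using j by (simp add: word_subst_def p_def Q_def flip: replicate_add)
    ultimately have swap: "c (w @ word_subst p t) = c (w @ word_subst p 0)" if "w \<in> W" for w
      using fun_cong[OF \<open>col j = col j'\<close>, of w] that by (simp add: col_def)
    define c' where "c' w = list_encode (map (\<lambda>x. c (w @ word_subst p x)) [0..<Suc t])" for w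
    have "\<forall>w. c' w \<in> R'" using c unfolding c'_def R'_def by (intro allI imageI) (auto simp del: upt_Suc)
    then obtain ps where ps: "length ps = n" "length (concat ps) = N"
       "\<forall>p\<in>set ps. None \<in> set p \<and> set p \<subseteq> insert None (Some ` {..<Suc t})"
       and c'_eq: "\<And>xs. length xs = n \<Longrightarrow> set xs \<subseteq> {..<Suc t} \<Longrightarrow>
          c' (subspace_word ps xs) = c' (subspace_word ps (map (collapse_letter t) xs))"
      using N by blast
    have eq: "c (subspace_word ps xs @ word_subst p x) =
        c (subspace_word ps (map (collapse_letter t) xs) @ word_subst p (collapse_letter t x))"
      if xs: "length xs = n" "set xs \<subseteq> {..<Suc t}" and x: "x < Suc t" for xs x
    proof -
      let ?ys = "map (collapse_letter t) xs"
      have "map (\<lambda>x. c (subspace_word ps xs @ word_subst p x)) [0..<Suc t] =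
            map (\<lambda>x. c (subspace_word ps ?ys @ word_subst p x)) [0..<Suc t]"
        using c'_eq[OF xs] by (metis c'_def list_encode_eq)
      then have "c (subspace_word ps xs @ word_subst p x) = c (subspace_word ps ?ys @ word_subst p x)"
        using x unfolding map_eq_conv set_upt by fastforce
      also have "\<dots> = c (subspace_word ps ?ys @ word_subst p (collapse_letter t x))"
      proof -
        have "set ?ys \<subseteq> {..<Suc t}" using xs by (auto simp: collapse_letter_def)
        then have "subspace_word ps ?ys \<in> W"
          using set_subspace_word[OF ps(3)] length_subspace_word[of ?ys ps] xs ps by (simp add: W_def)
        then show ?thesis using swap by (simp add: collapse_letter_def)
      qed
      finally show ?thesis .
    qed
    show "\<exists>ps. length ps = Suc n \<and> length (concat ps) = N + m \<and>
       (\<forall>p\<in>set ps. None \<in> set p \<and> set p \<subseteq> insert None (Some ` {..<Suc t})) \<and>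
       (\<forall>xs. length xs = Suc n \<and> set xs \<subseteq> {..<Suc t} \<longrightarrow>
          c (subspace_word ps xs) = c (subspace_word ps (map (collapse_letter t) xs)))"
    proof (intro exI[of _ "ps @ [p]"] conjI allI impI)
      fix zs assume zs: "length zs = Suc n \<and> set zs \<subseteq> {..<Suc t}"
      then obtain xs x where "zs = xs @ [x]" by (metis length_0_conv nat.distinct(1) rev_exhaust)
      then show "c (subspace_word (ps @ [p]) zs)
          = c (subspace_word (ps @ [p]) (map (collapse_letter t) zs))"
        using eq[of xs x] zs ps by (simp add: subspace_word_snoc)
    qed (use ps p_len p_None p_letters in auto)
  qed
qed

text \<open>Second step of Shelah's proof, by induction on the alphabet: inside a subspace where the
  colour cannot tell the letter \<open>t\<close> from 0, a line that is monochromatic for the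
  letters below \<open>t\<close> keeps its colour at \<open>t\<close>.\<close>

theorem hales_jewett:
  assumes "finite (R :: nat set)"
  shows "\<exists>N. \<forall>c. (\<forall>w. c w \<in> R) \<longrightarrow> (\<exists>l\<in>line_words L N. \<exists>k. \<forall>x<L. c (word_subst l x) = k)"
proof (induction L)
  case 0
  show ?case
    by (intro exI[of _ 1] allI impI bexI[of _ "[None]"]) (auto simp: line_words_def)
next
  case (Suc t)
  show ?case
  \<comment> \<open>For \<open>t = 0\<close> there is no other letter onto which \<open>t\<close>
    could be collapsed, but a one-letter line is trivially monochromatic.\<close>
  proof (cases "t = 0")
    case True
    then have "[None] \<in> line_words (Suc t) 1"
      and "\<forall>x<Suc t. c (word_subst [None] x) = c (word_subst [None] 0)" for c :: "nat list \<Rightarrow> nat"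
      by (auto simp: line_words_def)
    then show ?thesis by blast
  next
    case False
    obtain n where n: "\<And>c. (\<forall>w. c w \<in> R) \<Longrightarrow>
        \<exists>l\<in>line_words t n. \<exists>k. \<forall>x<t. c (word_subst l x) = k"
      using Suc by blast
    obtain N where N: "\<And>c. (\<forall>w. c w \<in> R) \<Longrightarrow>
      (\<exists>ps. length ps = n \<and> length (concat ps) = N \<and>
       (\<forall>p\<in>set ps. None \<in> set p \<and> set p \<subseteq> insert None (Some ` {..<Suc t})) \<and>
       (\<forall>xs. length xs = n \<and> set xs \<subseteq> {..<Suc t} \<longrightarrow>
          c (subspace_word ps xs) = c (subspace_word ps (map (collapse_letter t) xs))))"
      using insensitive_subspace[OF assms, of t n] False by (auto simp: Suc_le_eq)
    show ?thesis
    proof (intro exI[of _ N] allI impI)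
      fix c :: "nat list \<Rightarrow> nat" assume c: "\<forall>w. c w \<in> R"
      obtain ps where ps: "length ps = n" "length (concat ps) = N"
         "\<forall>p\<in>set ps. None \<in> set p \<and> set p \<subseteq> insert None (Some ` {..<Suc t})"
         and ins: "\<And>xs. length xs = n \<Longrightarrow> set xs \<subseteq> {..<Suc t} \<Longrightarrow>
            c (subspace_word ps xs) = c (subspace_word ps (map (collapse_letter t) xs))"
        using N[OF c] by blast
      obtain l k where l: "l \<in> line_words t n"
        and k: "\<And>x. x < t \<Longrightarrow> c (subspace_word ps (word_subst l x)) = k"
        using n[of "\<lambda>xs. c (subspace_word ps xs)"] c by blast
      have len_l: "length l = n" using l by (simp add: line_words_def)
      \<comment> \<open>Substituting the line \<open>l\<close> into the subspace: a constant letter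
        fixes its whole block, while an active coordinate leaves the variable of the block in place.
        All remaining variables then act as one.\<close>
      define fill where
        "fill p y = (case y of None \<Rightarrow> p | Some z \<Rightarrow> map Some (word_subst p z))" for p y
      define l' where "l' = concat (map2 fill ps l)"
      have subst: "word_subst l' x = subspace_word ps (word_subst l x)" for x
      proof -
        have "length ps = length l" using ps len_l by simp
        then show ?thesis unfolding l'_def
        proof (induction ps l rule: list_induct2)
          case (Cons p ps y l)
          then show ?case
            by (cases y) (simp_all add: fill_def subspace_word_def word_subst_def o_def)
        qed (simp add: subspace_word_def word_subst_def)
      qed
      have "length ps = length l" using ps len_l by simp
      then have "length l' = length (concat ps) \<and> (None \<in> set l \<longrightarrow> None \<in> set l')
          \<and> set l' \<subseteq> insert None (Some ` {..<Suc t})"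
        using ps(3) l[unfolded line_words_def, simplified, THEN conjunct2, THEN conjunct2]
        unfolding l'_def
      proof (induction ps l rule: list_induct2)
        case (Cons p ps y l)
        have "p \<in> line_words (Suc t) (length p)"
          using Cons.prems by (auto simp: line_words_def)
        then have "set (fill p y) \<subseteq> insert None (Some ` {..<Suc t}) \<and> length (fill p y) = length p
            \<and> (y = None \<longrightarrow> None \<in> set (fill p y))"
        proof (cases y)
          case None
          then show ?thesis using Cons.prems by (simp add: fill_def)
        next
          case (Some a)
          then have "a < Suc t" using Cons.prems by auto
          then have "set (word_subst p a) \<subseteq> {..<Suc t}"
            using set_word_subst \<open>p \<in> line_words (Suc t) (length p)\<close> by blast
          then show ?thesis using Some by (auto simp: fill_def)
        qed
        then show ?case using Cons.IH Cons.prems by auto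
      qed auto
      then have l': "l' \<in> line_words (Suc t) N"
        using ps l by (auto simp: line_words_def)
      have "c (word_subst l' x) = k" if "x < Suc t" for x
      proof (cases "x < t")
        case True
        then show ?thesis using k subst by simp
      next
        case False
        then have x: "x = t" using that by simp
        have letters: "set l \<subseteq> insert None (Some ` {..<t})" using l by (simp add: line_words_def)
        have "set (word_subst l t) \<subseteq> {..<Suc t}"
          using letters by (force simp: word_subst_def split: option.splits)
        moreover have "map (collapse_letter t) (word_subst l t) = word_subst l 0"
          using letters by (force simp: word_subst_def collapse_letter_def split: option.splits)
        ultimately show ?thesis
          using ins[of "word_subst l t"] k[of 0] False len_l subst x \<open>t \<noteq> 0\<close> by simp
      qed
      then show "\<exists>l\<in>line_words (Suc t) N. \<exists>k. \<forall>x<Suc t. c (word_subst l x) = k"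
        using l' by blast
    qed
  qed
qed

section \<open>The partite lemma\<close>

definition graph_emb ::
  "'u set \<Rightarrow> ('u \<Rightarrow> 'u \<Rightarrow> bool) \<Rightarrow> 'w set \<Rightarrow> ('w \<Rightarrow> 'w \<Rightarrow> bool) \<Rightarrow> ('u \<Rightarrow> 'w) \<Rightarrow> bool" where
  "graph_emb U R W S f \<longleftrightarrow> f ` U \<subseteq> W \<and> inj_on f U \<and> (\<forall>x\<in>U. \<forall>y\<in>U. S (f x) (f y) \<longleftrightarrow> R x y)"

definition graph_embs ::
  "'u set \<Rightarrow> ('u \<Rightarrow> 'u \<Rightarrow> bool) \<Rightarrow> 'w set \<Rightarrow> ('w \<Rightarrow> 'w \<Rightarrow> bool) \<Rightarrow> ('u \<Rightarrow> 'w) set" where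
  "graph_embs U R W S = {f \<in> extensional U. graph_emb U R W S f}"

lemma graph_emb_comp:
  "graph_emb U R W S f \<Longrightarrow> graph_emb W S X T g \<Longrightarrow> graph_emb U R X T (g \<circ> f)"
  unfolding graph_emb_def by (auto simp: image_subset_iff inj_on_def)

lemma graph_emb_restrict [simp]: "graph_emb U R W S (restrict f U) \<longleftrightarrow> graph_emb U R W S f"
  unfolding graph_emb_def by (auto simp: inj_on_def)

lemma graph_embs_comp:
  "f \<in> graph_embs U R W S \<Longrightarrow> graph_emb W S X T g \<Longrightarrow> restrict (g \<circ> f) U \<in> graph_embs U R X T"
  unfolding graph_embs_def by (auto intro: graph_emb_comp)

lemma finite_graph_embs:
  assumes "finite U" "finite W"
  shows "finite (graph_embs U R W S)"
proof (rule finite_subset)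
  show "graph_embs U R W S \<subseteq> U \<rightarrow>\<^sub>E W"
    by (auto simp: graph_embs_def graph_emb_def PiE_def)
qed (use assms in \<open>auto intro: finite_PiE\<close>)

text \<open>A homomorphism that separates adjacent vertices is injective on a clique.
  Clique-freeness is therefore pulled back along such maps, which is how it is always used
  below.\<close>

lemma has_clique_image:
  assumes "has_clique U R r" "\<And>x. x \<in> U \<Longrightarrow> f x \<in> W"
    and "\<And>x y. x \<in> U \<Longrightarrow> y \<in> U \<Longrightarrow> R x y \<Longrightarrow> S (f x) (f y) \<and> f x \<noteq> f y"
  shows "has_clique W S r"
proof -
  obtain C where C: "C \<subseteq> U" "finite C" "card C = r" "\<And>x y. x \<in> C \<Longrightarrow> y \<in> C \<Longrightarrow> x \<noteq> y \<Longrightarrow> R x y"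
    using assms(1) unfolding has_clique_def by blast
  have "inj_on f C"
    using C assms(3) by (meson inj_onI subsetD)
  then have "card (f ` C) = r" using C(3) by (simp add: card_image)
  moreover have "f ` C \<subseteq> W" using C assms(2) by blast
  moreover have "\<forall>x\<in>f ` C. \<forall>y\<in>f ` C. x \<noteq> y \<longrightarrow> S x y"
    using C assms(3) by blast
  ultimately show ?thesis using C unfolding has_clique_def by blast
qed

text \<open>\<open>P\<close> is partite over the base graph \<open>R0\<close>, and
  \<open>\<iota>\<close> is one placing of \<open>A\<close> in the base. The copies of
  \<open>A\<close> over \<open>\<iota>\<close>, listed in \<open>fs\<close>, are the letters of the
  Hales--Jewett alphabet, and \<open>N\<close> is the length of the words.\<close>

locale partite_step =
  fixes A :: "'a set" and EA :: "'a \<Rightarrow> 'a \<Rightarrow> bool"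
    and P :: "nat set" and R :: "nat \<Rightarrow> nat \<Rightarrow> bool"
    and proj :: "nat \<Rightarrow> nat" and R0 :: "nat \<Rightarrow> nat \<Rightarrow> bool" and \<iota> :: "'a \<Rightarrow> nat"
    and fs :: "('a \<Rightarrow> nat) list" and N :: nat
  assumes EA_sym: "EA x y \<Longrightarrow> EA y x"
    and inj_\<iota>: "inj_on \<iota> A"
    and fin_P: "finite P" and fin_A: "finite A"
    and graph_P: "is_graph P R"
    and hom: "R u v \<Longrightarrow> R0 (proj u) (proj v)"
    and irrefl: "\<not> R0 q q"
    and set_fs: "set fs = {f \<in> graph_embs A EA P R. \<forall>x\<in>A. proj (f x) = \<iota> x}"
    and N_pos: "N > 0"
begin

text \<open>Left summand: points of the \<open>N\<close>-th power of a part met by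
  \<open>\<iota>\<close>, shared by all lines. Right summand: vertices of the other parts,
  duplicated for every line.\<close>

type_synonym vtx = "(nat \<times> nat list) + (nat option list \<times> nat)"

definition part_index :: "nat \<Rightarrow> 'a" where "part_index q = inv_into A \<iota> q"

lemma part_index_\<iota> [simp]: "x \<in> A \<Longrightarrow> part_index (\<iota> x) = x"
  by (simp add: part_index_def inj_\<iota>)

definition fill :: "nat \<Rightarrow> nat option list \<Rightarrow> nat list" where
  "fill v l = map (\<lambda>p. case p of None \<Rightarrow> v | Some i \<Rightarrow> (fs ! i) (part_index (proj v))) l"

text \<open>The copy of \<open>P\<close> attached to a line. Constant letters are read as vertices
  of copies of \<open>A\<close>, active ones as the vertex \<open>v\<close> itself, so copies for
  different lines can meet only in the power.\<close>

definition line_copy :: "nat option list \<Rightarrow> nat \<Rightarrow> vtx" where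
  "line_copy l v = (if proj v \<in> \<iota> ` A then Inl (proj v, fill v l) else Inr (l, v))"

definition power_vertices :: "(nat \<times> nat list) set" where
  "power_vertices = {(q, us). q \<in> \<iota> ` A \<and> length us = N \<and> (\<forall>u\<in>set us. u \<in> P \<and> proj u = q)}"

text \<open>Over an edge of \<open>A\<close> all coordinates have to be adjacent, so that the copy of \<open>A\<close> given by a word
  is again a copy of \<open>A\<close>; over a non-edge one adjacent coordinate suffices, because
  the constant coordinates of a line are non-adjacent there.\<close>

definition power_adj :: "nat \<times> nat list \<Rightarrow> nat \<times> nat list \<Rightarrow> bool" where
  "power_adj p p' \<longleftrightarrow> fst p \<noteq> fst p' \<and>
     (if EA (part_index (fst p)) (part_index (fst p'))
      then \<forall>i<N. R (snd p ! i) (snd p' ! i)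
      else \<exists>i<N. R (snd p ! i) (snd p' ! i))"

definition new_vertices :: "vtx set" where
  "new_vertices = Inl ` power_vertices \<union>
     Inr ` {(l, v). l \<in> line_words (length fs) N \<and> v \<in> P \<and> proj v \<notin> \<iota> ` A}"

definition new_adj :: "vtx \<Rightarrow> vtx \<Rightarrow> bool" where
  "new_adj p p' \<longleftrightarrow> p \<in> new_vertices \<and> p' \<in> new_vertices \<and>
     (if isl p \<and> isl p' then power_adj (projl p) (projl p')
      else \<exists>l\<in>line_words (length fs) N. \<exists>u\<in>P. \<exists>v\<in>P.
        R u v \<and> p = line_copy l u \<and> p' = line_copy l v)"

definition new_proj :: "vtx \<Rightarrow> nat" where
  "new_proj p = (case p of Inl (q, us) \<Rightarrow> q | Inr (l, v) \<Rightarrow> proj v)"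

lemma R_sym: "R u v \<Longrightarrow> R v u" and R_P: "R u v \<Longrightarrow> u \<in> P \<and> v \<in> P \<and> u \<noteq> v"
  using graph_P by (auto simp: is_graph_def)

lemma fs_nth:
  assumes "i < length fs"
  shows "graph_emb A EA P R (fs ! i)" "x \<in> A \<Longrightarrow> proj ((fs ! i) x) = \<iota> x"
  using nth_mem[OF assms] unfolding set_fs by (auto simp: graph_embs_def)

lemma fs_nth_adj:
  "i < length fs \<Longrightarrow> x \<in> A \<Longrightarrow> y \<in> A \<Longrightarrow> R ((fs ! i) x) ((fs ! i) y) \<longleftrightarrow> EA x y"
  using fs_nth(1)[of i] by (auto simp: graph_emb_def)

lemma line_letter:
  assumes "l \<in> line_words L N" "i < N"
  shows "l ! i = None \<or> (\<exists>j<L. l ! i = Some j)"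
proof -
  have "l ! i \<in> insert None (Some ` {..<L})"
    using assms nth_mem[of i l] unfolding line_words_def by blast
  then show ?thesis by auto
qed

lemma line_None:
  assumes "l \<in> line_words L N"
  obtains i where "i < N" "l ! i = None"
  using assms unfolding line_words_def in_set_conv_nth by auto

lemma length_line: "l \<in> line_words L N \<Longrightarrow> length l = N"
  by (simp add: line_words_def)

lemma new_proj_line_copy [simp]: "new_proj (line_copy l v) = proj v"
  by (simp add: new_proj_def line_copy_def)

lemma line_copy_in:
  assumes l: "l \<in> line_words (length fs) N" and v: "v \<in> P"
  shows "line_copy l v \<in> new_vertices"
proof (cases "proj v \<in> \<iota> ` A")
  case True
  then obtain x where x: "x \<in> A" "proj v = \<iota> x" by blast
  have "fill v l ! i \<in> P \<and> proj (fill v l ! i) = \<iota> x" if i: "i < N" for i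
  proof -
    from line_letter[OF l i] show ?thesis
    proof
      assume "l ! i = None"
      then show ?thesis using x v i length_line[OF l] by (simp add: fill_def)
    next
      assume "\<exists>j<length fs. l ! i = Some j"
      then obtain j where j: "j < length fs" "l ! i = Some j" by blast
      then show ?thesis
        using x i length_line[OF l] fs_nth[OF j(1)] by (auto simp: fill_def graph_emb_def)
    qed
  qed
  moreover have "length (fill v l) = N" using length_line[OF l] by (simp add: fill_def)
  ultimately have "(proj v, fill v l) \<in> power_vertices"
    using x unfolding power_vertices_def by (auto simp: in_set_conv_nth)
  then show ?thesis using True by (simp add: line_copy_def new_vertices_def)
qed (use l v in \<open>simp add: line_copy_def new_vertices_def\<close>)

lemma line_copy_inj:
  assumes l: "l \<in> line_words (length fs) N" and eq: "line_copy l u = line_copy l v"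
  shows "u = v"
proof (cases "proj u \<in> \<iota> ` A")
  case True
  then have *: "fill u l = fill v l"
    using eq by (auto simp: line_copy_def split: if_splits)
  obtain i where i: "i < N" "l ! i = None" using line_None[OF l] .
  have "fill u l ! i = u" "fill v l ! i = v"
    using i length_line[OF l] by (auto simp: fill_def)
  then show ?thesis using * by metis
qed (use eq in \<open>auto simp: line_copy_def split: if_splits\<close>)

text \<open>Between power vertices, an active coordinate shows \<open>R u v\<close> and a constant
  one shows \<open>EA x y\<close>; the latter is neutral for the conjunction over an edge and for
  the disjunction over a non-edge. If a vertex lies outside the power, its tag reveals the line, and
  \<open>line_copy_inj\<close> finishes.\<close>

lemma line_copy_adj:
  assumes l: "l \<in> line_words (length fs) N" and uv: "u \<in> P" "v \<in> P"
  shows "new_adj (line_copy l u) (line_copy l v) \<longleftrightarrow> R u v"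
proof (cases "proj u \<in> \<iota> ` A \<and> proj v \<in> \<iota> ` A")
  case True
  then obtain x y where x: "x \<in> A" "proj u = \<iota> x" and y: "y \<in> A" "proj v = \<iota> y" by blast
  have len: "length l = N" using length_line[OF l] .
  have coord: "l ! i = None \<and> R (fill u l ! i) (fill v l ! i) = R u v
      \<or> l ! i \<noteq> None \<and> R (fill u l ! i) (fill v l ! i) = EA x y" if "i < N" for i
    using line_letter[OF l that] x y that len by (auto simp: fill_def fs_nth_adj)
  obtain i0 where i0: "i0 < N" "l ! i0 = None" using line_None[OF l] .
  have "new_adj (line_copy l u) (line_copy l v) \<longleftrightarrow> power_adj (\<iota> x, fill u l) (\<iota> y, fill v l)"
    using line_copy_in[OF l uv(1)] line_copy_in[OF l uv(2)] x y
    by (simp add: new_adj_def line_copy_def)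
  also have "\<dots> \<longleftrightarrow> \<iota> x \<noteq> \<iota> y \<and> R u v"
  proof (cases "EA x y")
    case True
    have "(\<forall>i<N. R (fill u l ! i) (fill v l ! i)) \<longleftrightarrow> R u v" using coord i0 True by metis
    then show ?thesis using x y True by (simp add: power_adj_def)
  next
    case False
    have "(\<exists>i<N. R (fill u l ! i) (fill v l ! i)) \<longleftrightarrow> R u v" using coord i0 False by metis
    then show ?thesis using x y False by (simp add: power_adj_def)
  qed
  also have "\<dots> \<longleftrightarrow> R u v"
    using hom[of u v] irrefl x y by auto
  finally show ?thesis .
next
  case False
  then have notl: "\<not> (isl (line_copy l u) \<and> isl (line_copy l v))"
    by (auto simp: line_copy_def)
  have inr: "l' = l" if "line_copy l' u' = line_copy l w" "proj w \<notin> \<iota> ` A" for l' u' w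
    using that by (auto simp: line_copy_def split: if_splits)
  show ?thesis
  proof
    assume "new_adj (line_copy l u) (line_copy l v)"
    then obtain l' u' v' where *: "R u' v'" "line_copy l u = line_copy l' u'"
      "line_copy l v = line_copy l' v'"
      using notl by (auto simp: new_adj_def)
    have "l' = l" using inr[of l' u' u] inr[of l' v' v] * False by auto
    then show "R u v" using * line_copy_inj[OF l] by metis
  next
    assume "R u v"
    then show "new_adj (line_copy l u) (line_copy l v)"
      using notl l uv line_copy_in unfolding new_adj_def by auto
  qed
qed

lemma line_copy_emb:
  "l \<in> line_words (length fs) N \<Longrightarrow> graph_emb P R new_vertices new_adj (line_copy l)"
  unfolding graph_emb_def
  using line_copy_in line_copy_adj line_copy_inj by (auto simp: inj_on_def)

lemma finite_new_vertices: "finite new_vertices"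
proof -
  have "power_vertices \<subseteq> \<iota> ` A \<times> {us. set us \<subseteq> P \<and> length us = N}"
    by (auto simp: power_vertices_def)
  moreover have "finite (\<iota> ` A \<times> {us. set us \<subseteq> P \<and> length us = N})"
    using fin_P fin_A by (intro finite_cartesian_product finite_lists_length_eq) auto
  ultimately have "finite power_vertices" by (rule finite_subset)
  moreover have "finite {(l, v). l \<in> line_words (length fs) N \<and> v \<in> P \<and> proj v \<notin> \<iota> ` A}"
    by (rule finite_subset[of _ "line_words (length fs) N \<times> P"]) (use fin_P in auto)
  ultimately show ?thesis by (simp add: new_vertices_def)
qed

lemma power_adj_sym: "power_adj p p' \<Longrightarrow> power_adj p' p"
  unfolding power_adj_def using EA_sym R_sym by (auto split: if_splits)

lemma graph_new: "is_graph new_vertices new_adj"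
  unfolding is_graph_def
proof (intro allI impI)
  fix p q assume pq: "new_adj p q"
  have "new_adj q p"
  proof (cases "isl p \<and> isl q")
    case True
    then show ?thesis using pq power_adj_sym by (simp add: new_adj_def)
  next
    case False
    then obtain l u v where "l \<in> line_words (length fs) N" "R u v" "u \<in> P" "v \<in> P"
        "p = line_copy l u" "q = line_copy l v"
      using pq by (auto simp: new_adj_def)
    then show ?thesis using line_copy_adj R_sym by blast
  qed
  moreover have "p \<noteq> q"
  proof
    assume "p = q"
    show False
    proof (cases "isl p")
      case True
      then show ?thesis using pq \<open>p = q\<close> by (auto simp: new_adj_def power_adj_def)
    next
      case False
      then obtain l u v where "l \<in> line_words (length fs) N" "R u v" "line_copy l u = line_copy l v"
        using pq \<open>p = q\<close> by (auto simp: new_adj_def)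
      then show False using line_copy_inj R_P by blast
    qed
  qed
  ultimately show "p \<in> new_vertices \<and> q \<in> new_vertices \<and> p \<noteq> q \<and> new_adj q p"
    using pq by (auto simp: new_adj_def)
qed

lemma new_adj_cases:
  assumes "new_adj p p'"
  obtains (power) q us q' us' where "p = Inl (q, us)" "p' = Inl (q', us')"
      "(q, us) \<in> power_vertices" "(q', us') \<in> power_vertices" "power_adj (q, us) (q', us')"
    | (copy) l u v where "\<not> (isl p \<and> isl p')" "l \<in> line_words (length fs) N" "R u v"
      "p = line_copy l u" "p' = line_copy l v"
proof (cases "isl p \<and> isl p'")
  case True
  then obtain z z' where z: "p = Inl z" "p' = Inl z'" unfolding isl_def by blast
  moreover have "z \<in> power_vertices" "z' \<in> power_vertices" "power_adj z z'"
    using assms z by (auto simp: new_adj_def new_vertices_def)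
  ultimately show ?thesis using power[of "fst z" "snd z" "fst z'" "snd z'"] by simp
next
  case False
  then have "\<exists>l\<in>line_words (length fs) N. \<exists>u\<in>P. \<exists>v\<in>P.
      R u v \<and> p = line_copy l u \<and> p' = line_copy l v"
    using assms by (simp add: new_adj_def)
  then show ?thesis using False copy by blast
qed

lemma power_adj_proj:
  assumes "(q, us) \<in> power_vertices" "(q', us') \<in> power_vertices" "power_adj (q, us) (q', us')"
  shows "R0 q q'"
proof -
  obtain i where "i < N" "R (us ! i) (us' ! i)"
    using assms(3) N_pos unfolding power_adj_def by (auto split: if_splits)
  then show ?thesis using hom[of "us ! i" "us' ! i"] assms(1,2) by (auto simp: power_vertices_def)
qed

lemma new_hom:
  assumes "new_adj p p'"
  shows "R0 (new_proj p) (new_proj p')"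
  using assms
proof (cases rule: new_adj_cases)
  case power
  then show ?thesis using power_adj_proj by (simp add: new_proj_def)
qed (simp add: hom)

text \<open>A clique inside the power lies over edges of \<open>A\<close> only, so all coordinates
  are adjacent and coordinate 0 maps it to a clique of \<open>P\<close>. A clique with a vertex
  tagged \<open>l\<close> lies entirely in the copy of \<open>P\<close> attached to
  \<open>l\<close>, because every edge at such a vertex comes from that copy.\<close>

lemma new_clique:
  assumes \<iota>: "\<And>x y. x \<in> A \<Longrightarrow> y \<in> A \<Longrightarrow> R0 (\<iota> x) (\<iota> y) \<Longrightarrow> EA x y"
    and "has_clique new_vertices new_adj r"
  shows "has_clique P R r"
proof -
  obtain C where C: "C \<subseteq> new_vertices" "finite C" "card C = r"
     "\<And>x y. x \<in> C \<Longrightarrow> y \<in> C \<Longrightarrow> x \<noteq> y \<Longrightarrow> new_adj x y"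
    using assms(2) unfolding has_clique_def by blast
  have clC: "has_clique C new_adj r" using C unfolding has_clique_def by blast
  show ?thesis
  proof (cases "\<forall>p\<in>C. isl p")
    case True
    show ?thesis
    proof (rule has_clique_image[OF clC, where f = "\<lambda>p. snd (projl p) ! 0"])
      fix p assume "p \<in> C"
      then show "snd (projl p) ! 0 \<in> P"
        using True C(1) N_pos by (force simp: new_vertices_def power_vertices_def)
    next
      fix p p' assume p: "p \<in> C" "p' \<in> C" and adj: "new_adj p p'"
      from adj have "R (snd (projl p) ! 0) (snd (projl p') ! 0)"
      proof (cases rule: new_adj_cases)
        case (power q us q' us')
        obtain x x' where x: "x \<in> A" "x' \<in> A" "q = \<iota> x" "q' = \<iota> x'"
          using power by (auto simp: power_vertices_def)
        then have "EA x x'" using \<iota> power_adj_proj power by blast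
        then show ?thesis using power N_pos x by (simp add: power_adj_def)
      next
        case copy
        then show ?thesis using p True by blast
      qed
      then show "R (snd (projl p) ! 0) (snd (projl p') ! 0)
          \<and> snd (projl p) ! 0 \<noteq> snd (projl p') ! 0"
        using R_P by blast
    qed
  next
    case False
    then obtain l v where lv: "Inr (l, v) \<in> C" by (metis isl_def old.sum.exhaust surj_pair)
    then have lv': "l \<in> line_words (length fs) N" "v \<in> P" "line_copy l v = Inr (l, v)"
      using C(1) by (auto simp: new_vertices_def line_copy_def)
    have sub: "\<exists>u\<in>P. p = line_copy l u" if "p \<in> C" for p
    proof (cases "p = Inr (l, v)")
      case True
      then show ?thesis using lv' by metis
    next
      case False
      then have "new_adj p (Inr (l, v))" using C(4) that lv by blast
      then show ?thesis
      proof (cases rule: new_adj_cases)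
        case (copy l' u' v')
        then have "l' = l" by (auto simp: line_copy_def split: if_splits)
        then show ?thesis using copy R_P by blast
      qed auto
    qed
    show ?thesis
    proof (rule has_clique_image[OF clC, where f = "inv_into P (line_copy l)"])
      fix p assume "p \<in> C"
      then show "inv_into P (line_copy l) p \<in> P" using sub by (metis imageI inv_into_into)
    next
      fix p p' assume p: "p \<in> C" "p' \<in> C" and adj: "new_adj p p'"
      obtain u u' where u: "u \<in> P" "p = line_copy l u" "u' \<in> P" "p' = line_copy l u'"
        using sub p by metis
      have "inj_on (line_copy l) P" using line_copy_inj[OF lv'(1)] by (auto simp: inj_on_def)
      then have "inv_into P (line_copy l) p = u" "inv_into P (line_copy l) p' = u'"
        using u by auto
      moreover have "R u u'" using adj u line_copy_adj lv' by blast
      ultimately show "R (inv_into P (line_copy l) p) (inv_into P (line_copy l) p')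
          \<and> inv_into P (line_copy l) p \<noteq> inv_into P (line_copy l) p'"
        using R_P by auto
    qed
  qed
qed

text \<open>The link to Hales--Jewett: words over \<open>fs\<close> are copies of \<open>A\<close>
  in the power, and the copy of \<open>P\<close> attached to \<open>l\<close> carries the
  \<open>i\<close>-th copy of \<open>A\<close> to the \<open>i\<close>-th point of the line. A
  monochromatic line thus gives a monochromatic copy of \<open>P\<close>.\<close>

lemma line_copy_word:
  assumes l: "l \<in> line_words (length fs) N" and i: "i < length fs" and x: "x \<in> A"
  shows "line_copy l ((fs ! i) x) = Inl (\<iota> x, map (\<lambda>j. (fs ! j) x) (word_subst l i))"
proof -
  have "fill ((fs ! i) x) l = map (\<lambda>j. (fs ! j) x) (word_subst l i)"
    unfolding fill_def word_subst_def map_map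
    by (intro map_cong refl) (use fs_nth(2)[OF i x] x in \<open>simp split: option.split\<close>)
  then show ?thesis using fs_nth(2)[OF i x] x by (simp add: line_copy_def)
qed

lemma monochromatic_copy:
  fixes col :: "('a \<Rightarrow> vtx) \<Rightarrow> bool"
  assumes N: "\<And>c. (\<forall>w. c w \<in> {0, 1 :: nat}) \<Longrightarrow>
      \<exists>l\<in>line_words (length fs) N. \<exists>k. \<forall>x<length fs. c (word_subst l x) = k"
  shows "\<exists>e. graph_emb P R new_vertices new_adj e \<and> (\<forall>v\<in>P. new_proj (e v) = proj v) \<and>
    (\<exists>k. \<forall>f\<in>graph_embs A EA P R. (\<forall>x\<in>A. proj (f x) = \<iota> x) \<longrightarrow> col (restrict (e \<circ> f) A) = k)"
proof -
  define F where "F w = restrict (\<lambda>x. Inl (\<iota> x, map (\<lambda>j. (fs ! j) x) w) :: vtx) A" for w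
  define c where "c w = (if col (F w) then 1 else 0 :: nat)" for w
  have "\<forall>w. c w \<in> {0, 1}" by (simp add: c_def)
  then obtain l k where l: "l \<in> line_words (length fs) N"
    and k: "\<And>i. i < length fs \<Longrightarrow> c (word_subst l i) = k"
    using N by blast
  have "col (restrict (line_copy l \<circ> f) A) = (k = 1)"
    if f: "f \<in> graph_embs A EA P R" "\<forall>x\<in>A. proj (f x) = \<iota> x" for f
  proof -
    have "f \<in> set fs" using f set_fs by blast
    then obtain i where i: "i < length fs" "f = fs ! i" by (metis in_set_conv_nth)
    have "restrict (line_copy l \<circ> f) A = F (word_subst l i)"
      using line_copy_word[OF l i(1)] i(2) by (auto simp: F_def restrict_def)
    moreover have "col (F (word_subst l i)) \<longleftrightarrow> k = 1"
      using k[OF i(1)] by (auto simp: c_def split: if_splits)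
    ultimately show ?thesis by simp
  qed
  then show ?thesis
    using line_copy_emb[OF l] by (intro exI[of _ "line_copy l"]) auto
qed

end

section \<open>Ordered Ramsey property of clique-free graphs\<close>

definition partite_graph ::
  "(nat \<Rightarrow> nat \<Rightarrow> bool) \<Rightarrow> nat set \<Rightarrow> (nat \<Rightarrow> nat \<Rightarrow> bool) \<Rightarrow> (nat \<Rightarrow> nat) \<Rightarrow> bool" where
  "partite_graph R0 P R proj \<longleftrightarrow>
     finite P \<and> is_graph P R \<and> (\<forall>u v. R u v \<longrightarrow> R0 (proj u) (proj v))"

text \<open>The colour \<open>k\<close> may vary with the placing \<open>\<iota>\<close>; only the
  choice among the copies over one placing must not matter.\<close>

definition partite_arrow ::
  "'a set \<Rightarrow> ('a \<Rightarrow> 'a \<Rightarrow> bool) \<Rightarrow> ('a \<Rightarrow> nat) set \<Rightarrow>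
     nat set \<Rightarrow> (nat \<Rightarrow> nat \<Rightarrow> bool) \<Rightarrow> (nat \<Rightarrow> nat) \<Rightarrow>
     nat set \<Rightarrow> (nat \<Rightarrow> nat \<Rightarrow> bool) \<Rightarrow> (nat \<Rightarrow> nat) \<Rightarrow> bool" where
  "partite_arrow A EA J P R proj P' R' proj' \<longleftrightarrow>
    (\<forall>col. \<exists>e. graph_emb P R P' R' e \<and> (\<forall>v\<in>P. proj' (e v) = proj v) \<and>
       (\<forall>\<iota>\<in>J. \<exists>k :: bool. \<forall>f\<in>graph_embs A EA P R.
          (\<forall>x\<in>A. proj (f x) = \<iota> x) \<longrightarrow> col (restrict (e \<circ> f) A) = k))"

lemma partite_ramsey_step:
  fixes A :: "'a set" and \<iota> :: "'a \<Rightarrow> nat"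
  assumes "finite A" "symp EA" "irreflp R0" "inj_on \<iota> A"
    and P: "partite_graph R0 P R proj"
  shows "\<exists>P' R' proj'. partite_graph R0 P' R' proj' \<and>
    (\<forall>r. (\<forall>x\<in>A. \<forall>y\<in>A. R0 (\<iota> x) (\<iota> y) \<longrightarrow> EA x y) \<and> \<not> has_clique P R r \<longrightarrow>
         \<not> has_clique P' R' r) \<and>
    partite_arrow A EA {\<iota>} P R proj P' R' proj'"
proof -
  have "finite {f \<in> graph_embs A EA P R. \<forall>x\<in>A. proj (f x) = \<iota> x}"
    using P assms(1) by (simp add: partite_graph_def finite_graph_embs)
  from finite_list[OF this]
  obtain fs where fs: "set fs = {f \<in> graph_embs A EA P R. \<forall>x\<in>A. proj (f x) = \<iota> x}" ..
  obtain N where N: "\<And>c. (\<forall>w. c w \<in> {0, 1 :: nat}) \<Longrightarrow>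
      \<exists>l\<in>line_words (length fs) N. \<exists>k. \<forall>x<length fs. c (word_subst l x) = k"
    using hales_jewett[of "{0, 1}" "length fs"] by auto
  \<comment> \<open>A constant colouring serves only to produce some line; its active coordinate
    forces a positive length.\<close>
  have "line_words (length fs) N \<noteq> {}" using N[of "\<lambda>_. 0"] by auto
  then have "N > 0" by (auto simp: line_words_def)
  then have "partite_step A EA P R proj R0 \<iota> fs N"
    using assms fs unfolding partite_step_def partite_graph_def symp_def irreflp_def by blast
  then interpret partite_step A EA P R proj R0 \<iota> fs N .
  \<comment> \<open>Recoding by natural numbers keeps all stages of the iteration in one
    type.\<close>
  define P' where "P' = to_nat ` new_vertices"
  define R' where "R' m n \<longleftrightarrow> m \<in> P' \<and> n \<in> P' \<and> new_adj (from_nat m) (from_nat n)" for m n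
  define proj' where "proj' m = new_proj (from_nat m)" for m
  have enc: "graph_emb new_vertices new_adj P' R' to_nat"
    by (auto simp: graph_emb_def P'_def R'_def)
  have "partite_graph R0 P' R' proj'"
    using finite_new_vertices graph_new new_hom
    by (fastforce simp: partite_graph_def is_graph_def P'_def R'_def proj'_def)
  moreover have "\<not> has_clique P' R' r"
    if "\<forall>x\<in>A. \<forall>y\<in>A. R0 (\<iota> x) (\<iota> y) \<longrightarrow> EA x y" "\<not> has_clique P R r" for r
  proof
    assume cl: "has_clique P' R' r"
    have "has_clique new_vertices new_adj r"
      using graph_new
      by (intro has_clique_image[OF cl, of from_nat]) (auto simp: P'_def R'_def is_graph_def)
    then show False using new_clique that by blast
  qed
  moreover have "partite_arrow A EA {\<iota>} P R proj P' R' proj'"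
    unfolding partite_arrow_def
  proof
    fix col :: "('a \<Rightarrow> nat) \<Rightarrow> bool"
    obtain e k where e: "graph_emb P R new_vertices new_adj e" "\<forall>v\<in>P. new_proj (e v) = proj v"
      "\<forall>f\<in>graph_embs A EA P R. (\<forall>x\<in>A. proj (f x) = \<iota> x) \<longrightarrow>
         col (restrict (to_nat \<circ> restrict (e \<circ> f) A) A) = k"
      using monochromatic_copy[OF N, of "\<lambda>g. col (restrict (to_nat \<circ> g) A)"] by auto
    have "restrict (to_nat \<circ> restrict (e \<circ> f) A) A = restrict (to_nat \<circ> e \<circ> f) A" for f
      by auto
    then show "\<exists>e. graph_emb P R P' R' e \<and> (\<forall>v\<in>P. proj' (e v) = proj v) \<and>
       (\<forall>\<iota>\<in>{\<iota>}. \<exists>k :: bool. \<forall>f\<in>graph_embs A EA P R.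
          (\<forall>x\<in>A. proj (f x) = \<iota> x) \<longrightarrow> col (restrict (e \<circ> f) A) = k)"
      using e graph_emb_comp[OF e(1) enc]
      by (intro exI[of _ "to_nat \<circ> e"] conjI ballI exI[of _ k]) (auto simp: proj'_def)
  qed
  ultimately show ?thesis by blast
qed

text \<open>Placings are treated one at a time. The outermost copy is chosen first:
  \<open>e2\<close> fixes the colour over the new placing on all of \<open>P1\<close>, and
  \<open>e1\<close> then treats the older placings for the pulled-back colouring. As
  \<open>e1\<close> preserves projections, copies over the new placing stay over it and nothing
  already gained is lost.\<close>

lemma partite_ramsey:
  fixes A :: "'a set" and J :: "('a \<Rightarrow> nat) set"
  assumes "finite A" "symp EA" "irreflp R0"
    and P: "partite_graph R0 P R proj"
    and "finite J" "\<forall>\<iota>\<in>J. inj_on \<iota> A"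
  shows "\<exists>P' R' proj'. partite_graph R0 P' R' proj' \<and>
    (\<forall>r. (\<forall>\<iota>\<in>J. \<forall>x\<in>A. \<forall>y\<in>A. R0 (\<iota> x) (\<iota> y) \<longrightarrow> EA x y) \<and> \<not> has_clique P R r \<longrightarrow>
         \<not> has_clique P' R' r) \<and>
    partite_arrow A EA J P R proj P' R' proj'"
  using assms(5,6)
proof (induction J rule: finite_induct)
  case empty
  have "graph_emb P R P R id" by (auto simp: graph_emb_def)
  then have "partite_arrow A EA {} P R proj P R proj"
    unfolding partite_arrow_def by (intro allI exI[of _ id]) auto
  then show ?case using P by blast
next
  case (insert \<iota> J)
  have inj: "\<forall>\<iota>\<in>J. inj_on \<iota> A" "inj_on \<iota> A" using insert.prems by auto
  from insert.IH[OF inj(1)] obtain P1 R1 proj1 where 1: "partite_graph R0 P1 R1 proj1"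
    "\<And>r. \<forall>\<iota>\<in>J. \<forall>x\<in>A. \<forall>y\<in>A. R0 (\<iota> x) (\<iota> y) \<longrightarrow> EA x y \<Longrightarrow> \<not> has_clique P R r \<Longrightarrow>
         \<not> has_clique P1 R1 r"
    "partite_arrow A EA J P R proj P1 R1 proj1"
    by blast
  from partite_ramsey_step[OF assms(1-3) inj(2) 1(1)] obtain P2 R2 proj2 where
    2: "partite_graph R0 P2 R2 proj2"
    "\<And>r. \<forall>x\<in>A. \<forall>y\<in>A. R0 (\<iota> x) (\<iota> y) \<longrightarrow> EA x y \<Longrightarrow> \<not> has_clique P1 R1 r \<Longrightarrow>
         \<not> has_clique P2 R2 r"
    "partite_arrow A EA {\<iota>} P1 R1 proj1 P2 R2 proj2"
    by blast
  have arrow: "partite_arrow A EA (insert \<iota> J) P R proj P2 R2 proj2"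
    unfolding partite_arrow_def
  proof
    fix col :: "('a \<Rightarrow> nat) \<Rightarrow> bool"
    obtain e2 k2 where e2: "graph_emb P1 R1 P2 R2 e2" "\<forall>v\<in>P1. proj2 (e2 v) = proj1 v"
       "\<forall>f\<in>graph_embs A EA P1 R1.
          (\<forall>x\<in>A. proj1 (f x) = \<iota> x) \<longrightarrow> col (restrict (e2 \<circ> f) A) = k2"
      using 2(3)[unfolded partite_arrow_def, rule_format, of col] by auto
    obtain e1 where e1: "graph_emb P R P1 R1 e1" "\<forall>v\<in>P. proj1 (e1 v) = proj v"
       "\<forall>\<iota>\<in>J. \<exists>k :: bool. \<forall>f\<in>graph_embs A EA P R.
          (\<forall>x\<in>A. proj (f x) = \<iota> x) \<longrightarrow> col (restrict (e2 \<circ> restrict (e1 \<circ> f) A) A) = k"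
      using 1(3)[unfolded partite_arrow_def, rule_format, of "\<lambda>g. col (restrict (e2 \<circ> g) A)"]
      by blast
    have e1_P: "e1 v \<in> P1" if "v \<in> P" for v using e1(1) that by (auto simp: graph_emb_def)
    have eq: "restrict (e2 \<circ> restrict (e1 \<circ> f) A) A = restrict (e2 \<circ> e1 \<circ> f) A" for f by auto
    have "col (restrict (e2 \<circ> e1 \<circ> f) A) = k2"
      if f: "f \<in> graph_embs A EA P R" "\<forall>x\<in>A. proj (f x) = \<iota> x" for f
    proof -
      have "f x \<in> P" if "x \<in> A" for x
        using f that by (auto simp: graph_embs_def graph_emb_def)
      then have "\<forall>x\<in>A. proj1 (restrict (e1 \<circ> f) A x) = \<iota> x"
        using f(2) e1(2) by simp
      then show ?thesis
        using e2(3) graph_embs_comp[OF f(1) e1(1)] eq[of f] by metis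
    qed
    then show "\<exists>e. graph_emb P R P2 R2 e \<and> (\<forall>v\<in>P. proj2 (e v) = proj v) \<and>
       (\<forall>\<iota>\<in>insert \<iota> J. \<exists>k :: bool. \<forall>f\<in>graph_embs A EA P R.
          (\<forall>x\<in>A. proj (f x) = \<iota> x) \<longrightarrow> col (restrict (e \<circ> f) A) = k)"
      using graph_emb_comp[OF e1(1) e2(1)] e1(2,3) e2(2) e1_P
      unfolding eq by (intro exI[of _ "e2 \<circ> e1"]) auto
  qed
  have "\<not> has_clique P2 R2 r" if "(\<forall>\<iota>\<in>insert \<iota> J. \<forall>x\<in>A. \<forall>y\<in>A. R0 (\<iota> x) (\<iota> y) \<longrightarrow> EA x y)"
    "\<not> has_clique P R r" for r
    using 1(2) 2(2) that by auto
  then show ?case using 2(1) arrow by blast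
qed

text \<open>The partite construction starts from disjoint copies of \<open>D\<close>, one for every
  \<open>\<phi>\<close> in \<open>\<Phi>\<close> and projected to the base by it. The resulting
  \<open>\<psi>\<close> is common to all \<open>\<phi>\<close>, so a suitable \<open>\<phi>\<close>
  can be chosen after \<open>\<psi>\<close> is known.\<close>

lemma ramsey_over_base:
  fixes A :: "'a set" and D :: "nat set" and \<Phi> :: "(nat \<Rightarrow> nat) set" and J :: "('a \<Rightarrow> nat) set"
  assumes A: "finite A" "symp EA" "irreflp R0"
    and D: "finite D" "is_graph D RD"
    and \<Phi>: "finite \<Phi>" "\<forall>\<phi>\<in>\<Phi>. \<forall>u v. RD u v \<longrightarrow> R0 (\<phi> u) (\<phi> v)"
    and J: "finite J" "\<forall>\<iota>\<in>J. inj_on \<iota> A"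
  shows "\<exists>(P :: nat set) R. finite P \<and> is_graph P R \<and>
    (\<forall>r. (\<forall>\<iota>\<in>J. \<forall>x\<in>A. \<forall>y\<in>A. R0 (\<iota> x) (\<iota> y) \<longrightarrow> EA x y) \<and> \<not> has_clique D RD r \<longrightarrow>
         \<not> has_clique P R r) \<and>
    (\<forall>col. \<exists>\<psi> :: ('a \<Rightarrow> nat) \<Rightarrow> bool. \<forall>\<phi>\<in>\<Phi>. \<exists>e. graph_emb D RD P R e \<and>
       (\<forall>f\<in>graph_embs A EA D RD. restrict (\<phi> \<circ> f) A \<in> J \<longrightarrow>
          col (restrict (e \<circ> f) A) = \<psi> (restrict (\<phi> \<circ> f) A)))"
proof -
  obtain \<phi>s where \<phi>s: "set \<phi>s = \<Phi>" using \<Phi>(1) finite_list by blast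
  define P where "P = prod_encode ` ({..<length \<phi>s} \<times> D)"
  define R where "R m n \<longleftrightarrow> m \<in> P \<and> n \<in> P \<and> fst (prod_decode m) = fst (prod_decode n) \<and>
     RD (snd (prod_decode m)) (snd (prod_decode n))" for m n
  define proj where "proj m = (\<phi>s ! fst (prod_decode m)) (snd (prod_decode m))" for m
  have "partite_graph R0 P R proj"
    unfolding partite_graph_def
  proof (intro conjI allI impI)
    show "finite P" using D by (simp add: P_def)
    show "is_graph P R" using D(2) by (auto simp: is_graph_def R_def)
    fix m n assume "R m n"
    then show "R0 (proj m) (proj n)"
      using \<Phi>(2) \<phi>s nth_mem by (auto simp: R_def proj_def P_def)
  qed
  note partite_ramsey[OF A(1-3) this J]
  then obtain P' R' proj' where P': "partite_graph R0 P' R' proj'"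
    and clique: "\<And>r. \<forall>\<iota>\<in>J. \<forall>x\<in>A. \<forall>y\<in>A. R0 (\<iota> x) (\<iota> y) \<longrightarrow> EA x y \<Longrightarrow> \<not> has_clique P R r \<Longrightarrow>
         \<not> has_clique P' R' r"
    and arrow: "partite_arrow A EA J P R proj P' R' proj'"
    by blast
  have "\<not> has_clique P R r" if "\<not> has_clique D RD r" for r
  proof
    assume cl: "has_clique P R r"
    have "has_clique D RD r"
      using D(2)
      by (intro has_clique_image[OF cl, of "snd \<circ> prod_decode"]) (auto simp: P_def R_def is_graph_def)
    then show False using that by blast
  qed
  then have clique': "\<not> has_clique P' R' r"
    if "(\<forall>\<iota>\<in>J. \<forall>x\<in>A. \<forall>y\<in>A. R0 (\<iota> x) (\<iota> y) \<longrightarrow> EA x y) \<and> \<not> has_clique D RD r" for r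
    using clique that by simp
  have \<psi>: "\<exists>\<psi> :: ('a \<Rightarrow> nat) \<Rightarrow> bool. \<forall>\<phi>\<in>\<Phi>. \<exists>e. graph_emb D RD P' R' e \<and>
       (\<forall>f\<in>graph_embs A EA D RD. restrict (\<phi> \<circ> f) A \<in> J \<longrightarrow>
          col (restrict (e \<circ> f) A) = \<psi> (restrict (\<phi> \<circ> f) A))" for col
  proof -
    obtain e0 \<psi> where e0: "graph_emb P R P' R' e0"
      and \<psi>: "\<And>\<iota> f. \<iota> \<in> J \<Longrightarrow> f \<in> graph_embs A EA P R \<Longrightarrow> (\<forall>x\<in>A. proj (f x) = \<iota> x) \<Longrightarrow>
          col (restrict (e0 \<circ> f) A) = \<psi> \<iota>"
      using arrow[unfolded partite_arrow_def, rule_format, of col] by metis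
    show ?thesis
    proof (intro exI[of _ \<psi>] ballI)
      fix \<phi> assume "\<phi> \<in> \<Phi>"
      then obtain i where i: "i < length \<phi>s" "\<phi> = \<phi>s ! i" using \<phi>s by (metis in_set_conv_nth)
      define c where "c v = prod_encode (i, v)" for v
      have c: "graph_emb D RD P R c"
        using i by (auto simp: graph_emb_def c_def P_def R_def inj_on_def)
      have "col (restrict (e0 \<circ> c \<circ> f) A) = \<psi> (restrict (\<phi> \<circ> f) A)"
        if f: "f \<in> graph_embs A EA D RD" "restrict (\<phi> \<circ> f) A \<in> J" for f
      proof -
        have "\<forall>x\<in>A. proj (restrict (c \<circ> f) A x) = restrict (\<phi> \<circ> f) A x"
          using i by (simp add: proj_def c_def)
        from \<psi>[OF f(2) graph_embs_comp[OF f(1) c] this]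
        have "col (restrict (e0 \<circ> restrict (c \<circ> f) A) A) = \<psi> (restrict (\<phi> \<circ> f) A)" .
        moreover have "restrict (e0 \<circ> restrict (c \<circ> f) A) A = restrict (e0 \<circ> c \<circ> f) A" by auto
        ultimately show ?thesis by simp
      qed
      then show "\<exists>e. graph_emb D RD P' R' e \<and>
       (\<forall>f\<in>graph_embs A EA D RD. restrict (\<phi> \<circ> f) A \<in> J \<longrightarrow>
          col (restrict (e \<circ> f) A) = \<psi> (restrict (\<phi> \<circ> f) A))"
        using graph_emb_comp[OF c e0] by blast
    qed
  qed
  have "finite P'" "is_graph P' R'" using P' by (simp_all add: partite_graph_def)
  with clique' \<psi> show ?thesis
    by (intro exI[of _ P'] exI[of _ R'] conjI allI impI)
qed

text \<open>The rank function is a canonical name for the order that \<open>\<rho>\<close> induces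
  on \<open>A\<close>: order-equivalent maps get literally the same function, and for finite
  \<open>A\<close> there are finitely many names.\<close>

definition order_type :: "'a set \<Rightarrow> ('a \<Rightarrow> nat) \<Rightarrow> 'a \<Rightarrow> nat" where
  "order_type A \<rho> = restrict (\<lambda>x. card {y \<in> A. \<rho> y < \<rho> x}) A"

lemma order_type_less_iff:
  assumes "\<And>x y. x \<in> A \<Longrightarrow> y \<in> A \<Longrightarrow> \<rho> x < \<rho> y \<longleftrightarrow> \<rho>' x < \<rho>' y"
  shows "order_type A \<rho> = order_type A \<rho>'"
  unfolding order_type_def using assms by (intro restrict_ext arg_cong[of _ _ card]) auto

lemma order_type_cong: "(\<And>x. x \<in> A \<Longrightarrow> \<rho> x = \<rho>' x) \<Longrightarrow> order_type A \<rho> = order_type A \<rho>'"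
  by (rule order_type_less_iff) simp

lemma order_type_restrict [simp]: "order_type A (restrict \<rho> A) = order_type A \<rho>"
  by (rule order_type_cong) simp

lemma order_type_in:
  assumes "finite A"
  shows "order_type A \<rho> \<in> A \<rightarrow>\<^sub>E {..<card A}"
proof -
  have "card {y \<in> A. \<rho> y < \<rho> x} < card A" if "x \<in> A" for x
    using assms that by (intro psubset_card_mono) auto
  then show ?thesis by (auto simp: order_type_def)
qed

lemma card_less_strict_mono:
  assumes "finite Y" "z \<in> Y" "z < (z' :: nat)"
  shows "card {y \<in> Y. y < z} < card {y \<in> Y. y < z'}"
  using assms by (intro psubset_card_mono) auto

text \<open>Once the images agree, the rank of \<open>x\<close> is the position of its value within
  the common image, and a position determines the value.\<close>

lemma order_type_image_inj:
  assumes "finite A" "inj_on \<rho> A" "inj_on \<rho>' A" "\<rho> ` A = \<rho>' ` A"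
    and eq: "order_type A \<rho> = order_type A \<rho>'" and x: "x \<in> A"
  shows "\<rho> x = \<rho>' x"
proof -
  define Y where "Y = \<rho> ` A"
  have fin: "finite Y" using assms by (simp add: Y_def)
  have rank: "order_type A \<tau> x = card {z \<in> Y. z < \<tau> x}" if "inj_on \<tau> A" "\<tau> ` A = Y" for \<tau>
  proof -
    have "{z \<in> Y. z < \<tau> x} = \<tau> ` {y \<in> A. \<tau> y < \<tau> x}" using that by auto
    moreover have "inj_on \<tau> {y \<in> A. \<tau> y < \<tau> x}" using that by (auto simp: inj_on_def)
    ultimately show ?thesis using x by (simp add: card_image order_type_def)
  qed
  have "card {z \<in> Y. z < \<rho> x} = card {z \<in> Y. z < \<rho>' x}"
    using rank[of \<rho>] rank[of \<rho>'] assms by (simp add: Y_def)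
  moreover have "\<rho> x \<in> Y" "\<rho>' x \<in> Y" using assms x by (auto simp: Y_def)
  ultimately show ?thesis
    using card_less_strict_mono[OF fin, of "\<rho> x" "\<rho>' x"] card_less_strict_mono[OF fin, of "\<rho>' x" "\<rho> x"]
    by (metis less_irrefl linorder_neqE_nat)
qed

text \<open>Ramsey's theorem is applied to subsets of size \<open>card A\<close>, each coloured by
  the set of order types of those injections onto it that satisfy \<open>\<psi>\<close>. Injections
  onto one set are told apart by their order types, so this colour records \<open>\<psi>\<close>
  completely.\<close>

lemma ramsey_injections:
  fixes A :: "'a set" and d :: nat
  assumes A: "finite A"
  shows "\<exists>p. \<forall>\<psi> :: ('a \<Rightarrow> nat) \<Rightarrow> bool. \<exists>Z \<Psi>. Z \<subseteq> {..<p} \<and> card Z = d \<and>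
    (\<forall>\<iota>\<in>extensional A. inj_on \<iota> A \<and> \<iota> ` A \<subseteq> Z \<longrightarrow> \<psi> \<iota> = \<Psi> (order_type A \<iota>))"
proof -
  define types where "types = A \<rightarrow>\<^sub>E {..<card A}"
  have "finite (Pow types)" using A by (simp add: types_def finite_PiE)
  then obtain h where h: "bij_betw h (Pow types) {..<card (Pow types)}"
    using ex_bij_betw_finite_nat[of "Pow types"] atLeast0LessThan by metis
  define q where "q = card (Pow types)"
  obtain p :: nat where p: "partn_lst {..<p} (replicate q d) (card A)" using ramsey_full by blast
  show ?thesis
  proof (intro exI[of _ p] allI)
    fix \<psi> :: "('a \<Rightarrow> nat) \<Rightarrow> bool"
    define col where "col Y = order_type A ` {\<iota> \<in> extensional A. inj_on \<iota> A \<and> \<iota> ` A = Y \<and> \<psi> \<iota>}" for Y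
    have col: "col Y \<in> Pow types" for Y
      unfolding col_def types_def using order_type_in[OF A] by blast
    have "(\<lambda>Y. h (col Y)) \<in> nsets {..<p} (card A) \<rightarrow> {..<q}"
      using col bij_betwE[OF h] by (auto simp: q_def)
    from partn_lstE[OF p this length_replicate] obtain i Z where
      i: "i < q" "Z \<in> nsets {..<p} (replicate q d ! i)"
         "(\<lambda>Y. h (col Y)) ` nsets Z (card A) \<subseteq> {i}"
      by auto
    have Z: "Z \<subseteq> {..<p}" "card Z = d" using i by (auto simp: nsets_def)
    \<comment> \<open>The common colour of the subsets of \<open>Z\<close> decodes to one set of
      order types, which serves as \<open>\<Psi>\<close>.\<close>
    have "\<psi> \<iota> \<longleftrightarrow> order_type A \<iota> \<in> inv_into (Pow types) h i"
      if \<iota>: "\<iota> \<in> extensional A" "inj_on \<iota> A" "\<iota> ` A \<subseteq> Z" for \<iota>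
    proof -
      have "\<iota> ` A \<in> nsets Z (card A)" using \<iota> A by (auto simp: nsets_def card_image)
      then have "h (col (\<iota> ` A)) = i" using i(3) by blast
      then have "inv_into (Pow types) h i = col (\<iota> ` A)"
        using col bij_betw_inv_into_left[OF h] by metis
      moreover have "\<psi> \<iota> \<longleftrightarrow> order_type A \<iota> \<in> col (\<iota> ` A)"
      proof
        assume "order_type A \<iota> \<in> col (\<iota> ` A)"
        then obtain \<iota>' where \<iota>': "\<iota>' \<in> extensional A" "inj_on \<iota>' A" "\<iota>' ` A = \<iota> ` A" "\<psi> \<iota>'"
          "order_type A \<iota> = order_type A \<iota>'" by (auto simp: col_def)
        then have "\<iota> = \<iota>'"
          using order_type_image_inj[OF A] \<iota> by (intro extensionalityI[of \<iota> A \<iota>']) metis+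
        then show "\<psi> \<iota>" using \<iota>' by simp
      qed (use \<iota> in \<open>auto simp: col_def\<close>)
      ultimately show ?thesis by simp
    qed
    then show "\<exists>Z \<Psi>. Z \<subseteq> {..<p} \<and> card Z = d \<and>
    (\<forall>\<iota>\<in>extensional A. inj_on \<iota> A \<and> \<iota> ` A \<subseteq> Z \<longrightarrow> \<psi> \<iota> = \<Psi> (order_type A \<iota>))"
      using Z by (intro exI[of _ Z] exI[of _ "\<lambda>\<sigma>. \<sigma> \<in> inv_into (Pow types) h i"]) auto
  qed
qed

lemma ordered_ramsey_graphs:
  fixes A :: "'a set" and D :: "nat set"
  assumes A: "finite A" "symp EA" and D: "finite D" "is_graph D RD"
  shows "\<exists>(G :: nat set) RG. finite G \<and> is_graph G RG \<and>
    (\<forall>col. \<exists>e \<rho> \<Psi>. graph_emb D RD G RG e \<and> inj_on (\<rho> :: nat \<Rightarrow> nat) D \<and>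
      (\<forall>f\<in>graph_embs A EA D RD. col (restrict (e \<circ> f) A) \<longleftrightarrow> \<Psi> (order_type A (\<rho> \<circ> f))))"
proof -
  obtain p where p: "\<And>\<psi> :: ('a \<Rightarrow> nat) \<Rightarrow> bool. \<exists>Z \<Psi>. Z \<subseteq> {..<p} \<and> card Z = card D \<and>
    (\<forall>\<iota>\<in>extensional A. inj_on \<iota> A \<and> \<iota> ` A \<subseteq> Z \<longrightarrow> \<psi> \<iota> = \<Psi> (order_type A \<iota>))"
    using ramsey_injections[OF A(1), of "card D"] by blast
  have irrefl: "irreflp ((\<noteq>) :: nat \<Rightarrow> nat \<Rightarrow> bool)" by (simp add: irreflp_def)
  define \<Phi> where "\<Phi> = {\<phi> \<in> D \<rightarrow>\<^sub>E {..<p}. inj_on \<phi> D}"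
  define J where "J = {\<iota> \<in> A \<rightarrow>\<^sub>E {..<p}. inj_on \<iota> A}"
  have fin: "finite \<Phi>" "finite J" unfolding \<Phi>_def J_def using A D by (simp_all add: finite_PiE)
  have hom: "\<forall>\<phi>\<in>\<Phi>. \<forall>u v. RD u v \<longrightarrow> \<phi> u \<noteq> \<phi> v"
  proof (intro ballI allI impI)
    fix \<phi> u v assume "\<phi> \<in> \<Phi>" "RD u v"
    moreover have "u \<in> D" "v \<in> D" "u \<noteq> v"
      using \<open>RD u v\<close> D(2) unfolding is_graph_def by blast+
    ultimately show "\<phi> u \<noteq> \<phi> v" by (auto simp: \<Phi>_def inj_on_def)
  qed
  have inj: "\<forall>\<iota>\<in>J. inj_on \<iota> A" by (simp add: J_def)
  from ramsey_over_base[OF A irrefl D fin(1) hom fin(2) inj]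
  obtain P R where P: "finite (P :: nat set)" "is_graph P R"
    and \<psi>: "\<forall>col. \<exists>\<psi> :: ('a \<Rightarrow> nat) \<Rightarrow> bool. \<forall>\<phi>\<in>\<Phi>. \<exists>e. graph_emb D RD P R e \<and>
       (\<forall>f\<in>graph_embs A EA D RD. restrict (\<phi> \<circ> f) A \<in> J \<longrightarrow>
          col (restrict (e \<circ> f) A) = \<psi> (restrict (\<phi> \<circ> f) A))"
    by (elim exE conjE) (rule that)
  have "\<exists>e \<rho> \<Psi>. graph_emb D RD P R e \<and> inj_on (\<rho> :: nat \<Rightarrow> nat) D \<and>
      (\<forall>f\<in>graph_embs A EA D RD. col (restrict (e \<circ> f) A) \<longleftrightarrow> \<Psi> (order_type A (\<rho> \<circ> f)))" for col
  proof -
    obtain \<psi> where \<psi>: "\<And>\<phi>. \<phi> \<in> \<Phi> \<Longrightarrow> \<exists>e. graph_emb D RD P R e \<and>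
       (\<forall>f\<in>graph_embs A EA D RD. restrict (\<phi> \<circ> f) A \<in> J \<longrightarrow>
          col (restrict (e \<circ> f) A) = \<psi> (restrict (\<phi> \<circ> f) A))"
      using \<psi>[rule_format, of col] by blast
    obtain Z \<Psi> where Z: "Z \<subseteq> {..<p}" "card Z = card D" and \<Psi>:
      "\<And>\<iota>. \<iota> \<in> extensional A \<Longrightarrow> inj_on \<iota> A \<Longrightarrow> \<iota> ` A \<subseteq> Z \<Longrightarrow> \<psi> \<iota> = \<Psi> (order_type A \<iota>)"
      using p[of \<psi>] by blast
    have "finite Z" using Z finite_subset by blast
    then obtain \<phi>0 where \<phi>0: "bij_betw \<phi>0 D Z" using finite_same_card_bij[OF D(1)] Z by metis
    define \<phi> where "\<phi> = restrict \<phi>0 D"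
    have \<phi>: "\<phi> ` D = Z" "inj_on \<phi> D"
      using \<phi>0 by (auto simp: \<phi>_def bij_betw_def inj_on_def)
    have "\<phi> \<in> \<Phi>" using \<phi> Z(1) by (auto simp: \<Phi>_def \<phi>_def)
    then obtain e where e: "graph_emb D RD P R e"
       "\<And>f. f\<in>graph_embs A EA D RD \<Longrightarrow> restrict (\<phi> \<circ> f) A \<in> J \<Longrightarrow>
          col (restrict (e \<circ> f) A) = \<psi> (restrict (\<phi> \<circ> f) A)"
      using \<psi> by blast
    have "col (restrict (e \<circ> f) A) \<longleftrightarrow> \<Psi> (order_type A (\<phi> \<circ> f))"
      if f: "f \<in> graph_embs A EA D RD" for f
    proof -
      have f': "f ` A \<subseteq> D" "inj_on f A" using f by (auto simp: graph_embs_def graph_emb_def)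
      then have inj: "inj_on (\<phi> \<circ> f) A" using \<phi>(2) by (meson comp_inj_on inj_on_subset)
      have im: "(\<phi> \<circ> f) ` A \<subseteq> Z" using f' \<phi>(1) by auto
      have "restrict (\<phi> \<circ> f) A \<in> J"
        using inj im Z(1) by (auto simp: J_def inj_on_def subset_iff)
      then show ?thesis
        using e(2)[OF f] \<Psi>[of "restrict (\<phi> \<circ> f) A"] inj im by simp
    qed
    then show ?thesis using e(1) \<phi>(2) by blast
  qed
  then show ?thesis using P by blast
qed

text \<open>The run over \<open>G\<close>. The function \<open>\<psi>\<close> colours copies of
  \<open>A\<close> in \<open>G\<close>, and the previous lemma provides a copy of \<open>D\<close>
  in \<open>G\<close> on which it depends on the order alone. Placings are now induced copies of
  \<open>A\<close>, which is the condition under which no cliques arise.\<close>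

theorem clique_free_ordered_ramsey:
  fixes A :: "'a set" and D :: "nat set"
  assumes A: "finite A" "symp EA" and D: "finite D" "is_graph D RD"
  shows "\<exists>(P :: nat set) R. finite P \<and> is_graph P R \<and>
    (\<forall>r. \<not> has_clique D RD r \<longrightarrow> \<not> has_clique P R r) \<and>
    (\<forall>col. \<exists>e \<rho> \<Psi>. graph_emb D RD P R e \<and> inj_on (\<rho> :: nat \<Rightarrow> nat) D \<and>
      (\<forall>f\<in>graph_embs A EA D RD. col (restrict (e \<circ> f) A) \<longleftrightarrow> \<Psi> (order_type A (\<rho> \<circ> f))))"
proof -
  obtain G RG where G: "finite (G :: nat set)" "is_graph G RG" and
    low: "\<And>col. \<exists>e \<rho> \<Psi>. graph_emb D RD G RG e \<and> inj_on (\<rho> :: nat \<Rightarrow> nat) D \<and>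
      (\<forall>f\<in>graph_embs A EA D RD. col (restrict (e \<circ> f) A) \<longleftrightarrow> \<Psi> (order_type A (\<rho> \<circ> f)))"
    using ordered_ramsey_graphs[OF A D] by blast
  define \<Phi> where "\<Phi> = graph_embs D RD G RG"
  define J where "J = graph_embs A EA G RG"
  have irrefl: "irreflp RG" using G(2) by (auto simp: is_graph_def irreflp_def)
  have fin: "finite \<Phi>" "finite J" using finite_graph_embs A D G by (auto simp: \<Phi>_def J_def)
  have hom: "\<forall>\<phi>\<in>\<Phi>. \<forall>u v. RD u v \<longrightarrow> RG (\<phi> u) (\<phi> v)"
    using D(2) by (auto simp: \<Phi>_def graph_embs_def graph_emb_def is_graph_def)
  have inj: "\<forall>\<iota>\<in>J. inj_on \<iota> A"
    by (simp add: J_def graph_embs_def graph_emb_def)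
  have full: "\<forall>\<iota>\<in>J. \<forall>x\<in>A. \<forall>y\<in>A. RG (\<iota> x) (\<iota> y) \<longrightarrow> EA x y"
    by (simp add: J_def graph_embs_def graph_emb_def)
  from ramsey_over_base[OF A irrefl D fin(1) hom fin(2) inj]
  obtain P R where P: "finite (P :: nat set)" "is_graph P R"
      and clique: "\<forall>r. (\<forall>\<iota>\<in>J. \<forall>x\<in>A. \<forall>y\<in>A. RG (\<iota> x) (\<iota> y) \<longrightarrow> EA x y) \<and> \<not> has_clique D RD r \<longrightarrow>
         \<not> has_clique P R r"
    and \<psi>: "\<forall>col. \<exists>\<psi> :: ('a \<Rightarrow> nat) \<Rightarrow> bool. \<forall>\<phi>\<in>\<Phi>. \<exists>e. graph_emb D RD P R e \<and>
       (\<forall>f\<in>graph_embs A EA D RD. restrict (\<phi> \<circ> f) A \<in> J \<longrightarrow>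
          col (restrict (e \<circ> f) A) = \<psi> (restrict (\<phi> \<circ> f) A))"
    by (elim exE conjE) (rule that)
  have clique: "\<forall>r. \<not> has_clique D RD r \<longrightarrow> \<not> has_clique P R r"
    using clique full by simp
  have "\<exists>e \<rho> \<Psi>. graph_emb D RD P R e \<and> inj_on (\<rho> :: nat \<Rightarrow> nat) D \<and>
      (\<forall>f\<in>graph_embs A EA D RD. col (restrict (e \<circ> f) A) \<longleftrightarrow> \<Psi> (order_type A (\<rho> \<circ> f)))" for col
  proof -
    obtain \<psi> where \<psi>: "\<And>\<phi>. \<phi> \<in> \<Phi> \<Longrightarrow> \<exists>e. graph_emb D RD P R e \<and>
       (\<forall>f\<in>graph_embs A EA D RD. restrict (\<phi> \<circ> f) A \<in> J \<longrightarrow>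
          col (restrict (e \<circ> f) A) = \<psi> (restrict (\<phi> \<circ> f) A))"
      using \<psi>[rule_format, of col] by blast
    obtain g \<rho> \<Psi> where g: "graph_emb D RD G RG g" "inj_on (\<rho> :: nat \<Rightarrow> nat) D"
      "\<And>f. f \<in> graph_embs A EA D RD \<Longrightarrow> \<psi> (restrict (g \<circ> f) A) \<longleftrightarrow> \<Psi> (order_type A (\<rho> \<circ> f))"
      using low[of \<psi>] by blast
    have "restrict g D \<in> \<Phi>" using g(1) by (simp add: \<Phi>_def graph_embs_def)
    then obtain e where e: "graph_emb D RD P R e"
       "\<And>f. f\<in>graph_embs A EA D RD \<Longrightarrow> restrict (restrict g D \<circ> f) A \<in> J \<Longrightarrow>
          col (restrict (e \<circ> f) A) = \<psi> (restrict (restrict g D \<circ> f) A)"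
      using \<psi> by blast
    have "col (restrict (e \<circ> f) A) \<longleftrightarrow> \<Psi> (order_type A (\<rho> \<circ> f))"
      if f: "f \<in> graph_embs A EA D RD" for f
    proof -
      have "f x \<in> D" if "x \<in> A" for x using f that by (auto simp: graph_embs_def graph_emb_def)
      then have eq: "restrict (restrict g D \<circ> f) A = restrict (g \<circ> f) A" by (auto simp: restrict_def)
      moreover have "restrict (g \<circ> f) A \<in> J" unfolding J_def using graph_embs_comp[OF f g(1)] .
      ultimately show ?thesis using e(2)[OF f] g(3)[OF f] by simp
    qed
    then show ?thesis using e(1) g(2) by blast
  qed
  with P show ?thesis
    by (intro exI[of _ P] exI[of _ R] conjI allI clique[THEN spec])
qed

section \<open>Minimal sets\<close>

lemma Emb_eq_graph_embs: "Emb A V E = graph_embs A E V E"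
  by (auto simp: Emb_def graph_embs_def graph_emb_def extensional_def)

lemma graph_embs_restrict_range:
  "f \<in> graph_embs U R W S \<Longrightarrow> f ` U \<subseteq> X \<Longrightarrow> f \<in> graph_embs U R X S"
  unfolding graph_embs_def graph_emb_def by blast

lemma topspace_cantor_top [simp]: "topspace (cantor_top H) = H \<rightarrow>\<^sub>E UNIV"
  by (simp add: cantor_top_def)

lemma compact_space_cantor_top: "compact_space (cantor_top H)"
  unfolding cantor_top_def by (simp add: compact_space_product_topology compact_space_discrete_topology)

lemma cantor_closure_agree:
  assumes x: "x \<in> cantor_top H closure_of Y" and J: "finite J" "J \<subseteq> H"
  obtains y where "y \<in> Y" "\<And>f. f \<in> J \<Longrightarrow> y f = x f"
proof -
  define U where "U = PiE H (\<lambda>f. if f \<in> J then {x f} else UNIV)"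
  have "finite {f \<in> H. (if f \<in> J then {x f} else UNIV) \<noteq> topspace (discrete_topology UNIV)}"
    by (rule finite_subset[OF _ J(1)]) auto
  then have "openin (cantor_top H) U"
    unfolding U_def cantor_top_def openin_PiE_gen by simp
  moreover have "x \<in> U" using x by (auto simp: U_def in_closure_of)
  ultimately obtain y where "y \<in> Y" "y \<in> U" using x unfolding in_closure_of by blast
  moreover have "y f = x f" if "f \<in> J" for f
    using \<open>y \<in> U\<close> that J(2) by (auto simp: U_def dest!: PiE_mem[of y H _ f])
  ultimately show ?thesis using that by blast
qed

lemma orbit_subset_topspace: "orbit A V E c \<subseteq> topspace (cantor_top (Emb A V E))"
  by (auto simp: orbit_def flow_act_def)

lemma Aut_graph_emb: "g \<in> Aut V E \<Longrightarrow> graph_emb V E V E g"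
  by (auto simp: Aut_def graph_emb_def bij_betw_def)

lemma emb_act_in_Emb:
  assumes "f \<in> Emb A V E" "g \<in> Aut V E"
  shows "emb_act A g f \<in> Emb A V E"
  using graph_embs_comp[of f A E V E V E g] assms Aut_graph_emb[of g V E]
  by (simp add: Emb_eq_graph_embs emb_act_def)

lemma flow_act_char_set:
  assumes "f \<in> Emb A V E" "g \<in> Aut V E"
  shows "flow_act A (Emb A V E) (char_set (Emb A V E) S) g f \<longleftrightarrow> emb_act A g f \<in> S"
  using assms emb_act_in_Emb[OF assms] by (simp add: flow_act_def char_set_def)

lemma flow_act_id:
  assumes "c \<in> extensional (Emb A V E)"
  shows "flow_act A (Emb A V E) c id = c"
proof
  fix f
  have "emb_act A id f = f" if "f \<in> Emb A V E"
    using that by (auto simp: emb_act_def Emb_def restrict_def)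
  then show "flow_act A (Emb A V E) c id f = c f"
    using assms by (auto simp: flow_act_def extensional_def)
qed

lemma mem_orbit_closure_self:
  assumes "c \<in> extensional (Emb A V E)"
  shows "c \<in> orbit_closure A V E c"
proof -
  have "id \<in> Aut V E" by (simp add: Aut_def)
  then have "c \<in> orbit A V E c" using flow_act_id[OF assms] by (force simp: orbit_def)
  then show ?thesis
    unfolding orbit_closure_def using closure_of_subset[OF orbit_subset_topspace] by blast
qed

text \<open>Stated for points \<open>c\<close> of the flow rather than for sets, because it is first
  obtained for a limit point. Both \<open>\<rho>\<close> and \<open>\<Psi>\<close> may change with
  \<open>F\<close>.\<close>

definition order_determined ::
  "'v set \<Rightarrow> 'v set \<Rightarrow> ('v \<Rightarrow> 'v \<Rightarrow> bool) \<Rightarrow> (('v \<Rightarrow> 'v) \<Rightarrow> bool) \<Rightarrow> 'v set \<Rightarrow> bool" where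
  "order_determined A V E c F \<longleftrightarrow>
    (\<exists>(\<rho> :: 'v \<Rightarrow> nat) \<Psi>. inj_on \<rho> F \<and>
       (\<forall>f\<in>Emb A V E. f ` A \<subseteq> F \<longrightarrow> (c f \<longleftrightarrow> \<Psi> (order_type A (\<rho> \<circ> f)))))"

lemma order_determined_mono:
  assumes "order_determined A V E c F" "F' \<subseteq> F"
  shows "order_determined A V E c F'"
proof -
  obtain \<rho> \<Psi> where "inj_on (\<rho> :: 'a \<Rightarrow> nat) F"
    "\<forall>f\<in>Emb A V E. f ` A \<subseteq> F \<longrightarrow> (c f \<longleftrightarrow> \<Psi> (order_type A (\<rho> \<circ> f)))"
    using assms(1) unfolding order_determined_def by (elim exE conjE) (rule that)
  moreover from this have "inj_on \<rho> F'" using assms(2) inj_on_subset by blast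
  ultimately show ?thesis
    unfolding order_determined_def using assms(2)
    by (intro exI[of _ \<rho>] exI[of _ \<Psi>]) (simp add: subset_trans)
qed

lemma order_determined_cong:
  assumes "order_determined A V E c F" "\<And>f. f \<in> Emb A V E \<Longrightarrow> f ` A \<subseteq> F \<Longrightarrow> c' f = c f"
  shows "order_determined A V E c' F"
proof -
  obtain \<rho> \<Psi> where "inj_on (\<rho> :: 'a \<Rightarrow> nat) F"
    "\<forall>f\<in>Emb A V E. f ` A \<subseteq> F \<longrightarrow> (c f \<longleftrightarrow> \<Psi> (order_type A (\<rho> \<circ> f)))"
    using assms(1) unfolding order_determined_def by (elim exE conjE) (rule that)
  then show ?thesis
    unfolding order_determined_def using assms(2) by (intro exI[of _ \<rho>] exI[of _ \<Psi>]) simp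
qed

text \<open>The order on the translate is pulled back along \<open>g\<close>. This serves to return
  from the limit point to \<open>S\<close>, and later to bring patterns on different translates back
  to one set.\<close>

lemma order_determined_act:
  assumes g: "g \<in> Aut V E" and F: "F \<subseteq> V" and det: "order_determined A V E c (g ` F)"
  shows "order_determined A V E (\<lambda>f. c (emb_act A g f)) F"
proof -
  obtain \<rho> \<Psi> where \<rho>: "inj_on (\<rho> :: 'a \<Rightarrow> nat) (g ` F)"
    and \<Psi>: "\<forall>f\<in>Emb A V E. f ` A \<subseteq> g ` F \<longrightarrow> (c f \<longleftrightarrow> \<Psi> (order_type A (\<rho> \<circ> f)))"
    using det unfolding order_determined_def by (elim exE conjE) (rule that)
  have "inj_on g F"
    using g F inj_on_subset[of g V F] by (simp add: Aut_def bij_betw_def)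
  then have "inj_on (\<rho> \<circ> g) F" using comp_inj_on \<rho> by blast
  moreover have "c (emb_act A g f) \<longleftrightarrow> \<Psi> (order_type A ((\<rho> \<circ> g) \<circ> f))"
    if f: "f \<in> Emb A V E" "f ` A \<subseteq> F" for f
  proof -
    have "emb_act A g f ` A \<subseteq> g ` F" using f(2) by (auto simp: emb_act_def)
    moreover have "order_type A (\<rho> \<circ> emb_act A g f) = order_type A ((\<rho> \<circ> g) \<circ> f)"
      by (rule order_type_cong) (simp add: emb_act_def)
    ultimately show ?thesis using bspec[OF \<Psi> emb_act_in_Emb[OF f(1) g]] by simp
  qed
  ultimately show ?thesis
    unfolding order_determined_def
    by (intro exI[of _ "\<rho> \<circ> g"] exI[of _ \<Psi>] conjI ballI impI)
qed

lemma finite_Emb_into: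
  assumes "finite A" "finite F"
  shows "finite {f \<in> Emb A V E. f ` A \<subseteq> F}"
proof (rule finite_subset)
  show "{f \<in> Emb A V E. f ` A \<subseteq> F} \<subseteq> A \<rightarrow>\<^sub>E F"
    unfolding Emb_def PiE_def extensional_def by blast
  show "finite (A \<rightarrow>\<^sub>E F)" using assms by (simp add: finite_PiE)
qed

text \<open>The Ramsey witness \<open>P\<close> for \<open>F\<close> is clique-free, so it embeds by
  the age condition, and its copies of \<open>A\<close> are coloured by membership in
  \<open>S\<close>. Ultrahomogeneity extends the map from \<open>F\<close> onto the good copy to an
  automorphism.\<close>

lemma order_determined_translate:
  assumes G: "random_Kr_free_graph r V E" and A: "finite A" and F: "finite F" "F \<subseteq> V"
  shows "\<exists>g\<in>Aut V E. order_determined A V E (flow_act A (Emb A V E) (char_set (Emb A V E) S) g) F"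
proof -
  have graph: "is_graph V E" and homog: "ultrahomogeneous V E"
    and age: "\<And>(W :: nat set) R. finite W \<Longrightarrow> is_graph W R \<Longrightarrow> \<not> has_clique W R r \<Longrightarrow> graph_embeds W R V E"
    and free: "\<not> has_clique F E r"
    using G F unfolding random_Kr_free_graph_def by simp_all
  have sym: "symp E" using graph by (auto simp: is_graph_def symp_def)
  have irrefl: "\<not> E z z" for z using graph by (auto simp: is_graph_def)
  obtain h :: "'a \<Rightarrow> nat" where h: "inj_on h F"
    using F(1) finite_imp_inj_to_nat_seg by blast
  define D where "D = h ` F"
  define RD where "RD m n \<longleftrightarrow> m \<in> D \<and> n \<in> D \<and> E (inv_into F h m) (inv_into F h n)" for m n
  have D: "finite D" "is_graph D RD"
    using F graph irrefl by (auto simp: D_def RD_def is_graph_def)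
  have h_emb: "graph_emb F E D RD h"
    using h by (simp add: graph_emb_def D_def RD_def)
  have "\<not> has_clique D RD r"
  proof
    assume cl: "has_clique D RD r"
    have "has_clique F E r"
    proof (rule has_clique_image[OF cl, of "inv_into F h"])
      show "inv_into F h m \<in> F" if "m \<in> D" for m using that by (simp add: D_def inv_into_into)
      show "E (inv_into F h m) (inv_into F h n) \<and> inv_into F h m \<noteq> inv_into F h n"
        if "RD m n" for m n
        using that irrefl unfolding RD_def by metis
    qed
    then show False using free by blast
  qed
  from clique_free_ordered_ramsey[OF A sym D]
  obtain P R where P: "finite (P :: nat set)" "is_graph P R"
    and clique: "\<forall>r. \<not> has_clique D RD r \<longrightarrow> \<not> has_clique P R r"
    and ram: "\<forall>col. \<exists>e \<rho> \<Psi>. graph_emb D RD P R e \<and> inj_on (\<rho> :: nat \<Rightarrow> nat) D \<and>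
      (\<forall>f\<in>graph_embs A E D RD. col (restrict (e \<circ> f) A) \<longleftrightarrow> \<Psi> (order_type A (\<rho> \<circ> f)))"
    by (elim exE conjE) (rule that)
  have "graph_embeds P R V E"
    using age[OF P] clique \<open>\<not> has_clique D RD r\<close> by blast
  then obtain k where k: "graph_emb P R V E k"
    unfolding graph_embeds_def graph_emb_def by blast
  obtain e \<rho> \<Psi> where e: "graph_emb D RD P R e" and \<rho>: "inj_on (\<rho> :: nat \<Rightarrow> nat) D"
    and \<Psi>: "\<forall>f\<in>graph_embs A E D RD. restrict (k \<circ> restrict (e \<circ> f) A) A \<in> S \<longleftrightarrow>
        \<Psi> (order_type A (\<rho> \<circ> f))"
    using ram[THEN spec, of "\<lambda>u. restrict (k \<circ> u) A \<in> S"] by (elim exE conjE) (rule that)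
  define m where "m = k \<circ> e \<circ> h"
  have m: "graph_emb F E V E m"
    unfolding m_def using graph_emb_comp[OF graph_emb_comp[OF h_emb e] k] by (simp add: comp_assoc)
  have "bij_betw m F (m ` F)" "m ` F \<subseteq> V" "\<forall>x\<in>F. \<forall>y\<in>F. E (m x) (m y) \<longleftrightarrow> E x y"
    using m by (auto simp: graph_emb_def bij_betw_def)
  then obtain g where g: "g \<in> Aut V E" "\<forall>x\<in>F. g x = m x"
    using homog[unfolded ultrahomogeneous_def, THEN spec[of _ F], THEN spec[of _ "m ` F"],
        THEN spec[of _ m]] F by blast
  have "flow_act A (Emb A V E) (char_set (Emb A V E) S) g f \<longleftrightarrow> \<Psi> (order_type A ((\<rho> \<circ> h) \<circ> f))"
    if f: "f \<in> Emb A V E" "f ` A \<subseteq> F" for f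
  proof -
    from graph_embs_comp[OF graph_embs_restrict_range[OF f[unfolded Emb_eq_graph_embs]] h_emb]
    have hf: "restrict (h \<circ> f) A \<in> graph_embs A E D RD" .
    have "emb_act A g f = restrict (k \<circ> restrict (e \<circ> restrict (h \<circ> f) A) A) A"
      unfolding emb_act_def
    proof (rule restrict_ext)
      fix x assume x: "x \<in> A"
      then have "f x \<in> F" using f(2) by blast
      then have "g (f x) = m (f x)" using g(2) by blast
      then show "(g \<circ> f) x = (k \<circ> restrict (e \<circ> restrict (h \<circ> f) A) A) x"
        using x by (simp add: m_def)
    qed
    moreover have "order_type A (\<rho> \<circ> restrict (h \<circ> f) A) = order_type A ((\<rho> \<circ> h) \<circ> f)"
      by (rule order_type_cong) simp
    ultimately show ?thesis
      using bspec[OF \<Psi> hf] flow_act_char_set[OF f(1) g(1), of S] by simp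
  qed
  moreover have "inj_on (\<rho> \<circ> h) F" using comp_inj_on[OF h] \<rho> by (simp add: D_def)
  ultimately show ?thesis
    using g(1) unfolding order_determined_def
    by (intro bexI[of _ g] exI[of _ "\<rho> \<circ> h"] exI[of _ \<Psi>] conjI ballI impI)
qed

text \<open>By compactness the orbit closure contains a point that is order-determined on every finite
  set; minimality brings its pattern on \<open>F\<close> back to \<open>S\<close> itself.\<close>

theorem minimal_subset_order_determined:
  assumes G: "random_Kr_free_graph r V E" and A: "finite A"
    and S: "minimal_subset A V E S" and F: "finite F" "F \<subseteq> V"
  shows "order_determined A V E (\<lambda>f. f \<in> S) F"
proof -
  let ?H = "Emb A V E"
  let ?c = "char_set ?H S"
  define Y where "Y F = {flow_act A ?H ?c g | g. g \<in> Aut V E \<and>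
     order_determined A V E (flow_act A ?H ?c g) F}" for F
  have Y_orbit: "Y F \<subseteq> orbit A V E ?c" for F by (auto simp: Y_def orbit_def)
  have Y_mono: "Y F' \<subseteq> Y F" if "F \<subseteq> F'" for F F'
    unfolding Y_def using order_determined_mono[OF _ that] by blast
  define \<U> where "\<U> = (\<lambda>F. cantor_top ?H closure_of Y F) ` {F. finite F \<and> F \<subseteq> V}"
  have "\<Inter>\<F> \<noteq> {}" if \<F>: "finite \<F>" "\<F> \<subseteq> \<U>" for \<F>
  proof -
    obtain \<G> where \<G>: "\<G> \<subseteq> {F. finite F \<and> F \<subseteq> V}" "finite \<G>"
        "\<F> = (\<lambda>F. cantor_top ?H closure_of Y F) ` \<G>"
      using finite_subset_image[OF \<F>[unfolded \<U>_def]] by blast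
    \<comment> \<open>Finite intersections are non-empty because order-determinacy on the union
      passes to each of the finitely many sets.\<close>
    have fin: "finite (\<Union>\<G>)" "\<Union>\<G> \<subseteq> V" using \<G> by auto
    obtain g where "g \<in> Aut V E" "order_determined A V E (flow_act A ?H ?c g) (\<Union>\<G>)"
      using order_determined_translate[OF G A fin, of S] by (elim bexE) (rule that)
    then obtain y where y: "y \<in> Y (\<Union>\<G>)"
      unfolding Y_def by blast
    have "y \<in> cantor_top ?H closure_of Y F" if "F \<in> \<G>" for F
    proof -
      have "y \<in> Y F" using y Y_mono[of F "\<Union>\<G>"] that by blast
      then show ?thesis
        by (rule subsetD[OF closure_of_subset[OF subset_trans[OF Y_orbit orbit_subset_topspace]]])
    qed
    then show ?thesis using \<G>(3) by blast
  qed
  moreover have "\<forall>C\<in>\<U>. closedin (cantor_top ?H) C" by (auto simp: \<U>_def)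
  ultimately have "\<Inter>\<U> \<noteq> {}"
    using compact_space_cantor_top[of ?H, unfolded compact_space_fip, THEN spec, of \<U>] by blast
  then obtain y where y: "\<And>F. finite F \<Longrightarrow> F \<subseteq> V \<Longrightarrow> y \<in> cantor_top ?H closure_of Y F"
    by (auto simp: \<U>_def)
  have det: "order_determined A V E y F" if F: "finite F" "F \<subseteq> V" for F
  proof -
    \<comment> \<open>On a finite \<open>F\<close> the property involves only finitely many
      coordinates of \<open>y\<close>, and there \<open>y\<close> agrees with a point of
      \<open>Y F\<close>.\<close>
    obtain z where z: "z \<in> Y F" "\<And>f. f \<in> {f \<in> ?H. f ` A \<subseteq> F} \<Longrightarrow> z f = y f"
      using cantor_closure_agree[OF y[OF F] finite_Emb_into[OF A F(1)]] by blast
    have "order_determined A V E z F" using z(1) by (auto simp: Y_def)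
    then show ?thesis by (rule order_determined_cong) (use z(2) in simp)
  qed
  have "y \<in> orbit_closure A V E ?c"
    using y[of "{}"] closure_of_mono[OF Y_orbit] unfolding orbit_closure_def by blast
  then have "orbit_closure A V E y = orbit_closure A V E ?c"
    using S unfolding minimal_subset_def by blast
  moreover have "?c \<in> orbit_closure A V E ?c"
    by (rule mem_orbit_closure_self) (simp add: char_set_def)
  ultimately have "?c \<in> cantor_top ?H closure_of orbit A V E y"
    by (simp add: orbit_closure_def)
  then obtain z where z: "z \<in> orbit A V E y" "\<And>f. f \<in> {f \<in> ?H. f ` A \<subseteq> F} \<Longrightarrow> z f = ?c f"
    using cantor_closure_agree[OF _ finite_Emb_into[OF A F(1)]] by blast
  then obtain g where g: "g \<in> Aut V E" "z = flow_act A ?H y g" by (auto simp: orbit_def)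
  have "g ` F \<subseteq> V"
    using g(1) F(2) by (auto simp: Aut_def bij_betw_def)
  then have "order_determined A V E (\<lambda>f. y (emb_act A g f)) F"
    using order_determined_act[OF g(1) F(2) det] F(1) by simp
  then show ?thesis
    by (rule order_determined_cong) (use z(2) g(2) in \<open>simp add: char_set_def flow_act_def\<close>)
qed

lemma dense_orbit_pattern:
  assumes dense: "cantor_top (Emb A V E) closure_of orbit A V E (char_set (Emb A V E) T)
           = topspace (cantor_top (Emb A V E))"
    and J: "finite J" "J \<subseteq> Emb A V E"
  shows "\<exists>g\<in>Aut V E. \<forall>f\<in>J. emb_act A g f \<in> T \<longleftrightarrow> \<tau> f"
proof -
  have "restrict \<tau> (Emb A V E) \<in> cantor_top (Emb A V E) closure_of orbit A V E (char_set (Emb A V E) T)"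
    unfolding dense by simp
  then obtain z where z: "z \<in> orbit A V E (char_set (Emb A V E) T)"
    "\<And>f. f \<in> J \<Longrightarrow> z f = restrict \<tau> (Emb A V E) f"
    using cantor_closure_agree[OF _ J] by blast
  then obtain g where g: "g \<in> Aut V E" "z = flow_act A (Emb A V E) (char_set (Emb A V E) T) g"
    by (auto simp: orbit_def)
  have "emb_act A g f \<in> T \<longleftrightarrow> \<tau> f" if "f \<in> J" for f
    using z(2)[OF that] flow_act_char_set[of f A V E g T] g J(2) that by auto
  then show ?thesis using g(1) by blast
qed

section \<open>Counting patterns on a blow-up\<close>

text \<open>Only finitely many generators enter the construction of a member, and the member is a
  union of atoms of these.\<close>

lemma gen_bool_alg_finitely_determined:
  assumes "X \<in> gen_bool_alg H M"
  shows "\<exists>\<F>. finite \<F> \<and> \<F> \<subseteq> M \<and>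
    (\<forall>s\<in>H. \<forall>t\<in>H. (\<forall>S\<in>\<F>. s \<in> S \<longleftrightarrow> t \<in> S) \<longrightarrow> (s \<in> X \<longleftrightarrow> t \<in> X))"
  using assms
proof induction
  case (gen S)
  then show ?case by (intro exI[of _ "{S}"]) simp
next
  case top
  then show ?case by (intro exI[of _ "{}"]) simp
next
  case (compl S)
  obtain \<F> where \<F>: "finite \<F>" "\<F> \<subseteq> M"
    "\<forall>s\<in>H. \<forall>t\<in>H. (\<forall>S\<in>\<F>. s \<in> S \<longleftrightarrow> t \<in> S) \<longrightarrow> (s \<in> S \<longleftrightarrow> t \<in> S)"
    using compl.IH by (elim exE conjE) (rule that)
  show ?case
  proof (intro exI[of _ \<F>] conjI ballI impI)
    fix s t assume st: "s \<in> H" "t \<in> H" "\<forall>S\<in>\<F>. s \<in> S \<longleftrightarrow> t \<in> S"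
    then show "s \<in> H - S \<longleftrightarrow> t \<in> H - S"
      using \<F>(3)[rule_format, OF st(1,2)] by simp
  qed (use \<F> in auto)
next
  case (union S T)
  obtain \<F> where \<F>: "finite \<F>" "\<F> \<subseteq> M"
    "\<forall>s\<in>H. \<forall>t\<in>H. (\<forall>S\<in>\<F>. s \<in> S \<longleftrightarrow> t \<in> S) \<longrightarrow> (s \<in> S \<longleftrightarrow> t \<in> S)"
    using union.IH(1) by (elim exE conjE) (rule that)
  obtain \<G> where \<G>: "finite \<G>" "\<G> \<subseteq> M"
    "\<forall>s\<in>H. \<forall>t\<in>H. (\<forall>S\<in>\<G>. s \<in> S \<longleftrightarrow> t \<in> S) \<longrightarrow> (s \<in> T \<longleftrightarrow> t \<in> T)"
    using union.IH(2) by (elim exE conjE) (rule that)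
  show ?case
  proof (intro exI[of _ "\<F> \<union> \<G>"] conjI ballI impI)
    fix s t assume st: "s \<in> H" "t \<in> H" "\<forall>S\<in>\<F> \<union> \<G>. s \<in> S \<longleftrightarrow> t \<in> S"
    then have "s \<in> S \<longleftrightarrow> t \<in> S" "s \<in> T \<longleftrightarrow> t \<in> T"
      using \<F>(3)[rule_format, OF st(1,2)] \<G>(3)[rule_format, OF st(1,2)] by (simp_all add: ball_Un)
    then show "s \<in> S \<union> T \<longleftrightarrow> t \<in> S \<union> T" by simp
  qed (use \<F> \<G> in auto)
qed

section \<open>Codes for order-determined patterns, and the estimate that they are too few\<close>

lemma graph_embs_restrict_domain:
  "f \<in> graph_embs U R W S \<Longrightarrow> U' \<subseteq> U \<Longrightarrow> restrict f U' \<in> graph_embs U' R W S"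
  unfolding graph_embs_def graph_emb_def
  by (auto simp: inj_on_def subset_iff image_subset_iff)

text \<open>The ranks in \<open>F\<close> order its points exactly as \<open>\<rho>\<close> does, so
  \<open>\<rho>\<close> may be replaced by a function with values below \<open>card F\<close>. This
  is what bounds the number of orders.\<close>

lemma order_type_comp:
  fixes \<rho> :: "'a \<Rightarrow> nat"
  assumes F: "finite F" and f: "f ` A \<subseteq> F"
  shows "order_type A (\<rho> \<circ> f) = order_type A (order_type F \<rho> \<circ> f)"
proof (rule order_type_less_iff)
  have mono: "order_type F \<rho> u < order_type F \<rho> v" if "u \<in> F" "v \<in> F" "\<rho> u < \<rho> v" for u v
  proof -
    have "{y \<in> F. \<rho> y < \<rho> u} \<subset> {y \<in> F. \<rho> y < \<rho> v}" using that by auto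
    then show ?thesis using that F by (simp add: order_type_def psubset_card_mono)
  qed
  have eq: "order_type F \<rho> u = order_type F \<rho> v" if "u \<in> F" "v \<in> F" "\<rho> u = \<rho> v" for u v
    using that by (simp add: order_type_def)
  fix x y assume "x \<in> A" "y \<in> A"
  then have xy: "f x \<in> F" "f y \<in> F" using f by auto
  show "(\<rho> \<circ> f) x < (\<rho> \<circ> f) y \<longleftrightarrow> (order_type F \<rho> \<circ> f) x < (order_type F \<rho> \<circ> f) y"
    using mono[OF xy] mono[OF xy(2,1)] eq[OF xy]
    by (cases "\<rho> (f x)" "\<rho> (f y)" rule: linorder_cases) auto
qed

text \<open>A pair consists of a candidate rank function on \<open>F\<close> and the set of accepted
  order types. Counting all functions instead of permutations is a harmless overestimate.\<close>

definition order_codes :: "'v set \<Rightarrow> 'v set \<Rightarrow> (('v \<Rightarrow> nat) \<times> ('v \<Rightarrow> nat) set) set" where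
  "order_codes A F = (F \<rightarrow>\<^sub>E {..<card F}) \<times> Pow (A \<rightarrow>\<^sub>E {..<card A})"

lemma finite_order_codes: "finite A \<Longrightarrow> finite F \<Longrightarrow> finite (order_codes A F)"
  by (simp add: order_codes_def finite_PiE)

lemma card_order_codes:
  "finite A \<Longrightarrow> finite F \<Longrightarrow>
     card (order_codes A F) = card F ^ card F * 2 ^ (card A ^ card A)"
  by (simp add: order_codes_def card_cartesian_product card_Pow card_PiE finite_PiE)

lemma order_determined_code:
  assumes A: "finite A" and F: "finite F" and det: "order_determined A V E c F"
  shows "\<exists>p\<in>order_codes A F. \<forall>f\<in>Emb A V E. f ` A \<subseteq> F \<longrightarrow> (c f \<longleftrightarrow> order_type A (fst p \<circ> f) \<in> snd p)"
proof -
  obtain \<rho> \<Psi> where \<Psi>: "\<forall>f\<in>Emb A V E. f ` A \<subseteq> F \<longrightarrow> (c f \<longleftrightarrow> \<Psi> (order_type A ((\<rho> :: 'a \<Rightarrow> nat) \<circ> f)))"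
    using det unfolding order_determined_def by (elim exE conjE) (rule that)
  define p where "p = (order_type F \<rho>, {\<sigma> \<in> A \<rightarrow>\<^sub>E {..<card A}. \<Psi> \<sigma>})"
  have "p \<in> order_codes A F"
    using order_type_in[OF F] by (simp add: p_def order_codes_def)
  moreover have "c f \<longleftrightarrow> order_type A (fst p \<circ> f) \<in> snd p" if f: "f \<in> Emb A V E" "f ` A \<subseteq> F" for f
    using \<Psi> f order_type_comp[OF F f(2), of \<rho>] order_type_in[OF A, of "order_type F \<rho> \<circ> f"]
    by (simp add: p_def)
  ultimately show ?thesis by blast
qed

text \<open>In binary exponents, the left side grows like \<open>n\<close> times the logarithm of
  \<open>n\<close>, the right side like the square of \<open>n\<close>. In the application
  \<open>a\<close> is the size of \<open>An\<close>, \<open>c\<close> is \<open>a ^ a\<close>, and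
  \<open>k\<close> is the number of minimal sets.\<close>

lemma order_codes_too_few:
  fixes a c k :: nat
  shows "\<exists>n\<ge>1. ((a * n) ^ (a * n) * 2 ^ c) ^ k < (2 :: nat) ^ (n * n)"
proof -
  \<comment> \<open>With \<open>n\<close> a power of 2, its logarithm is the integer
    \<open>2 * u\<close>. The choice of \<open>u\<close> gives
    \<open>a + c + 2 * u \<le> 4 * u\<close> and \<open>4 * (k * (a + 1)) \<le> u\<close>, so the
    exponent is at most \<open>u * u * n\<close>, and \<open>u * u < n\<close>.\<close>
  define u where "u = 4 * (k * (a + 1)) + (a + c)"
  define n where "n = (2 :: nat) ^ (2 * u)"
  have n1: "n \<ge> 1" by (simp add: n_def)
  have "a * n \<le> 2 ^ a * n" using less_exp[of a] by (intro mult_right_mono) auto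
  also have "\<dots> = 2 ^ (a + 2 * u)" by (simp add: n_def power_add)
  finally have "(a * n) ^ (a * n) \<le> (2 ^ (a + 2 * u)) ^ (a * n)" by (intro power_mono) auto
  also have "\<dots> = 2 ^ ((a + 2 * u) * (a * n))" by (simp only: power_mult)
  finally have "((a * n) ^ (a * n) * 2 ^ c) ^ k \<le> (2 ^ ((a + 2 * u) * (a * n)) * 2 ^ c) ^ k"
    by (intro power_mono mult_right_mono) auto
  also have "\<dots> = 2 ^ (((a + 2 * u) * (a * n) + c) * k)"
    by (simp only: power_mult power_add)
  also have "\<dots> < 2 ^ (n * n)"
  proof (rule power_strict_increasing)
    have "(a + 2 * u) * (a * n) + c \<le> (a + 2 * u) * (a * n) + c * (n * (a + 1))"
      using n1 by simp
    also have "\<dots> \<le> (a + 2 * u) * ((a + 1) * n) + c * ((a + 1) * n)"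
      by (simp add: algebra_simps)
    also have "\<dots> = (a + c + 2 * u) * ((a + 1) * n)" by (simp add: algebra_simps)
    finally have "((a + 2 * u) * (a * n) + c) * k \<le> (a + c + 2 * u) * ((a + 1) * n) * k"
      by (rule mult_right_mono) simp
    also have "\<dots> = k * (a + 1) * (a + c + 2 * u) * n" by (simp add: algebra_simps)
    also have "\<dots> \<le> k * (a + 1) * (4 * u) * n"
      by (intro mult_right_mono mult_left_mono) (auto simp: u_def)
    also have "\<dots> \<le> u * u * n"
    proof -
      have "4 * (k * (a + 1)) \<le> u" by (simp add: u_def)
      then have "4 * (k * (a + 1)) * u * n \<le> u * u * n" by (intro mult_right_mono) auto
      then show ?thesis by (simp add: algebra_simps)
    qed
    also have "u * u * n < n * n"
    proof -
      have "u * u < 2 ^ u * (2 :: nat) ^ u"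
        by (rule mult_strict_mono) auto
      also have "\<dots> = n" by (simp add: n_def mult_2 power_add)
      finally show ?thesis using n1 by simp
    qed
    finally show "((a + 2 * u) * (a * n) + c) * k < n * n" .
  qed simp
  finally show ?thesis using n1 by blast
qed

text \<open>The blow-up of \<open>An\<close> in which every vertex is replaced by \<open>n\<close> independent copies has
  \<open>n\<^sup>2\<close> lifts of the edge \<open>ab\<close>, each extended to a copy of \<open>An\<close> through the zeroth copies of the
  remaining vertices.\<close>

lemma blow_up_embeddings:
  assumes G: "random_Kr_free_graph r V E" and A: "finite An" "An \<subseteq> V" and ab: "a \<in> An" "b \<in> An" "a \<noteq> b"
    and n: "n \<ge> 1"
  shows "\<exists>F s. finite F \<and> F \<subseteq> V \<and> card F = card An * n \<and>
    (\<forall>i<n. \<forall>j<n. s i j \<in> Emb An V E \<and> s i j ` An \<subseteq> F) \<and>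
    (\<forall>i<n. \<forall>j<n. \<forall>i'<n. \<forall>j'<n. s i j a = s i' j' a \<and> s i j b = s i' j' b \<longrightarrow> i = i' \<and> j = j')"
proof -
  have graph: "is_graph V E"
    and age: "\<And>(W :: nat set) R. finite W \<Longrightarrow> is_graph W R \<Longrightarrow> \<not> has_clique W R r \<Longrightarrow> graph_embeds W R V E"
    and free: "\<not> has_clique An E r"
    using G A unfolding random_Kr_free_graph_def by simp_all
  have irrefl: "\<not> E z z" for z using graph by (auto simp: is_graph_def)
  obtain \<theta> :: "'a \<Rightarrow> nat" where \<theta>: "inj_on \<theta> An"
    using A(1) finite_imp_inj_to_nat_seg by blast
  define vert where "vert x i = prod_encode (\<theta> x, i)" for x i
  define W where "W = case_prod vert ` (An \<times> {..<n})"
  define base where "base w = inv_into An \<theta> (fst (prod_decode w))" for w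
  define R where "R w w' \<longleftrightarrow> w \<in> W \<and> w' \<in> W \<and> E (base w) (base w')" for w w'
  have base [simp]: "base (vert x i) = x" if "x \<in> An" for x i
    using that \<theta> by (simp add: base_def vert_def)
  have vert_inj: "x = y \<and> i = j" if "vert x i = vert y j" "x \<in> An" "y \<in> An" for x y i j
    using that \<theta> by (auto simp: vert_def inj_on_def)
  have vert_W: "vert x i \<in> W" if "x \<in> An" "i < n" for x i
    using that by (auto simp: W_def)
  have W: "finite W" "card W = card An * n"
  proof -
    show "finite W" using A(1) by (simp add: W_def)
    have "inj_on (case_prod vert) (An \<times> {..<n})"
      by (rule inj_onI) (use vert_inj in \<open>auto simp: split_def\<close>)
    then show "card W = card An * n" by (simp add: W_def card_image card_cartesian_product)
  qed
  have base_An: "base w \<in> An" if "w \<in> W" for w using that by (auto simp: W_def)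
  have "is_graph W R"
    unfolding is_graph_def
  proof (intro allI impI)
    fix w w' assume "R w w'"
    moreover from this have "w \<noteq> w'" using irrefl by (auto simp: R_def)
    moreover have "E (base w') (base w)" using calculation(1) graph by (auto simp: R_def is_graph_def)
    ultimately show "w \<in> W \<and> w' \<in> W \<and> w \<noteq> w' \<and> R w' w" by (simp add: R_def)
  qed
  moreover have "\<not> has_clique W R r"
  proof
    assume cl: "has_clique W R r"
    have "has_clique An E r"
    proof (rule has_clique_image[OF cl, of base])
      show "E (base w) (base w') \<and> base w \<noteq> base w'" if "R w w'" for w w'
        using that irrefl unfolding R_def by metis
    qed (rule base_An)
    then show False using free by contradiction
  qed
  ultimately have "graph_embeds W R V E" using age W(1) by blast
  then have "\<exists>k. graph_emb W R V E k" by (simp add: graph_embeds_def graph_emb_def)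
  then obtain k where k: "graph_emb W R V E k" ..
  define f where "f i j x = (if x = a then vert a i else if x = b then vert b j else vert x 0)"
    for i j x
  define s where "s i j = restrict (k \<circ> f i j) An" for i j
  have f_emb: "graph_emb An E W R (f i j)" if ij: "i < n" "j < n" for i j
  proof -
    have f: "f i j x \<in> W \<and> base (f i j x) = x" if "x \<in> An" for x
      using that ab n ij vert_W by (auto simp: f_def)
    then have "inj_on (f i j) An" by (metis inj_onI)
    then show ?thesis using f by (auto simp: graph_emb_def R_def)
  qed
  have s_F: "s i j \<in> Emb An V E \<and> s i j ` An \<subseteq> k ` W" if "i < n" "j < n" for i j
  proof
    show "s i j \<in> Emb An V E"
      unfolding Emb_eq_graph_embs s_def graph_embs_def
      using graph_emb_comp[OF f_emb[OF that] k] by simp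
    show "s i j ` An \<subseteq> k ` W"
      using f_emb[OF that] by (auto simp: s_def graph_emb_def)
  qed
  have k_inj: "inj_on k W" "k ` W \<subseteq> V" using k by (simp_all add: graph_emb_def)
  \<comment> \<open>Separation is needed at \<open>a\<close> and \<open>b\<close> themselves, since
    membership in the lifted set sees only the restriction to these two vertices.\<close>
  have s_inj: "i = i' \<and> j = j'"
    if "i < n" "j < n" "i' < n" "j' < n" "s i j a = s i' j' a" "s i j b = s i' j' b" for i j i' j'
  proof -
    have "k (vert a i) = k (vert a i')" "k (vert b j) = k (vert b j')"
      using that ab by (simp_all add: s_def f_def)
    then have "vert a i = vert a i'" "vert b j = vert b j'"
      using inj_onD[OF k_inj(1)] vert_W that ab by metis+
    then show ?thesis using vert_inj ab by metis
  qed
  show ?thesis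
    using W k_inj s_F s_inj
    by (intro exI[of _ "k ` W"] exI[of _ s]) (simp add: card_image)
qed

theorem mainTheorem7:
  fixes r :: nat and V :: "'v set" and E :: "'v \<Rightarrow> 'v \<Rightarrow> bool"
    and a b :: 'v and T :: "('v \<Rightarrow> 'v) set"
  assumes "r \<ge> 3"
    and "random_Kr_free_graph r V E"
    and "a \<in> V" and "b \<in> V" and "a \<noteq> b" and "E a b"
    and "T \<subseteq> Emb {a, b} V E"
    and "cantor_top (Emb {a, b} V E) closure_of orbit {a, b} V E (char_set (Emb {a, b} V E) T)
           = topspace (cantor_top (Emb {a, b} V E))"
  shows "\<forall>An. finite An \<and> An \<subseteq> V \<and> {a, b} \<subseteq> An \<longrightarrow>
           {s \<in> Emb An V E. restrict s {a, b} \<in> T}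
             \<notin> gen_bool_alg (Emb An V E) {S. minimal_subset An V E S}"
proof (intro allI impI notI)
  fix An assume An: "finite An \<and> An \<subseteq> V \<and> {a, b} \<subseteq> An"
  let ?H = "Emb An V E"
  let ?T = "{s \<in> ?H. restrict s {a, b} \<in> T}"
  assume "?T \<in> gen_bool_alg ?H {S. minimal_subset An V E S}"
  from gen_bool_alg_finitely_determined[OF this]
  obtain \<M> where \<M>: "finite \<M>" "\<M> \<subseteq> {S. minimal_subset An V E S}"
    and determined: "\<forall>s\<in>?H. \<forall>t\<in>?H. (\<forall>S\<in>\<M>. s \<in> S \<longleftrightarrow> t \<in> S) \<longrightarrow> (s \<in> ?T \<longleftrightarrow> t \<in> ?T)"
    by (elim exE conjE) (rule that)
  \<comment> \<open>The number of minimal sets involved is fixed before \<open>n\<close>, so the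
    blow-up can be taken large compared with it.\<close>
  obtain n where n: "n \<ge> 1" and
    few: "((card An * n) ^ (card An * n) * 2 ^ (card An ^ card An)) ^ card \<M> < (2 :: nat) ^ (n * n)"
    using order_codes_too_few by blast
  have fin: "finite An" "An \<subseteq> V" and ab: "a \<in> An" "b \<in> An" using An by auto
  obtain F s where F: "finite F" "F \<subseteq> V" "card F = card An * n"
    and s: "\<forall>i<n. \<forall>j<n. s i j \<in> ?H \<and> s i j ` An \<subseteq> F"
    and s_inj: "\<forall>i<n. \<forall>j<n. \<forall>i'<n. \<forall>j'<n. s i j a = s i' j' a \<and> s i j b = s i' j' b \<longrightarrow> i = i' \<and> j = j'"
    using blow_up_embeddings[OF assms(2) fin ab \<open>a \<noteq> b\<close> n] by (elim exE conjE) (rule that)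
  let ?I = "{..<n} \<times> {..<n}"
  define e where "e = (\<lambda>(i, j). restrict (s i j) {a, b})"
  have e_Emb: "e ` ?I \<subseteq> Emb {a, b} V E"
  proof -
    have "restrict (s i j) {a, b} \<in> Emb {a, b} V E" if "i < n" "j < n" for i j
      using s that ab graph_embs_restrict_domain[of "s i j" An E V E "{a, b}"]
      by (simp add: Emb_eq_graph_embs)
    then show ?thesis by (auto simp: e_def)
  qed
  have e_inj: "inj_on e ?I"
  proof (rule inj_onI)
    fix p q assume pq: "p \<in> ?I" "q \<in> ?I" "e p = e q"
    obtain i j i' j' where ij: "p = (i, j)" "q = (i', j')" by (metis surj_pair)
    have "s i j a = s i' j' a" "s i j b = s i' j' b"
      using fun_cong[OF pq(3), of a] fun_cong[OF pq(3), of b] ij by (simp_all add: e_def)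
    then show "p = q" using s_inj pq ij by auto
  qed
  \<comment> \<open>Every subset \<open>\<tau>\<close> of the grid is prescribed as a pattern on the
    lifts of the edge; density realises it by a translation \<open>g \<tau>\<close>.\<close>
  have "\<exists>g\<in>Aut V E. \<forall>f\<in>e ` ?I. emb_act {a, b} g f \<in> T \<longleftrightarrow> f \<in> e ` \<tau>" for \<tau>
    by (rule dense_orbit_pattern[OF assms(8)]) (use e_Emb in auto)
  then obtain g where g: "\<And>\<tau>. g \<tau> \<in> Aut V E"
    and g_pattern: "\<And>\<tau> p. p \<in> ?I \<Longrightarrow> emb_act {a, b} (g \<tau>) (e p) \<in> T \<longleftrightarrow> e p \<in> e ` \<tau>"
    by (metis imageI)
  have pattern: "emb_act An (g \<tau>) (s i j) \<in> ?T \<longleftrightarrow> (i, j) \<in> \<tau>"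
    if "i < n" "j < n" "\<tau> \<subseteq> ?I" for i j \<tau>
  proof -
    have ij: "(i, j) \<in> ?I" using that by simp
    have "restrict (emb_act An (g \<tau>) (s i j)) {a, b} = emb_act {a, b} (g \<tau>) (e (i, j))"
      using ab by (auto simp: emb_act_def e_def restrict_def)
    then have "emb_act An (g \<tau>) (s i j) \<in> ?T \<longleftrightarrow> e (i, j) \<in> e ` \<tau>"
      using g_pattern[OF ij] emb_act_in_Emb[OF _ g] s that by simp
    also have "\<dots> \<longleftrightarrow> (i, j) \<in> \<tau>"
      using inj_on_image_mem_iff[OF e_inj ij that(3)] .
    finally show ?thesis .
  qed
  \<comment> \<open>Order-determinacy is used on the translate of \<open>F\<close>, which depends on
    \<open>\<tau>\<close>, but the resulting code lives on \<open>F\<close> itself, so all codes are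
    counted in one finite set.\<close>
  have "\<exists>p\<in>order_codes An F. \<forall>f\<in>?H. f ` An \<subseteq> F \<longrightarrow>
      (emb_act An (g \<tau>) f \<in> S \<longleftrightarrow> order_type An (fst p \<circ> f) \<in> snd p)" if "S \<in> \<M>" for S \<tau>
  proof (rule order_determined_code)
    have "g \<tau> ` F \<subseteq> V" using g[of \<tau>] F(2) by (auto simp: Aut_def bij_betw_def)
    moreover have "minimal_subset An V E S" using \<M>(2) that by blast
    ultimately have "order_determined An V E (\<lambda>f. f \<in> S) (g \<tau> ` F)"
      using minimal_subset_order_determined[OF assms(2) fin(1)] F(1) by simp
    then show "order_determined An V E (\<lambda>f. emb_act An (g \<tau>) f \<in> S) F"
      by (rule order_determined_act[OF g F(2)])
  qed (use An F in auto)
  then obtain code where code: "\<And>S \<tau>. S \<in> \<M> \<Longrightarrow> code S \<tau> \<in> order_codes An F"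
    and code_iff: "\<And>S \<tau> f. S \<in> \<M> \<Longrightarrow> f \<in> ?H \<Longrightarrow> f ` An \<subseteq> F \<Longrightarrow>
      emb_act An (g \<tau>) f \<in> S \<longleftrightarrow> order_type An (fst (code S \<tau>) \<circ> f) \<in> snd (code S \<tau>)"
    by metis
  define codes where "codes \<tau> = restrict (\<lambda>S. code S \<tau>) \<M>" for \<tau>
  \<comment> \<open>The codes of \<open>\<tau>\<close> determine which translated lifts lie in each
    set of \<open>\<M>\<close>, hence by \<open>determined\<close> which of them lie in
    \<open>?T\<close>, and that is \<open>\<tau>\<close>.\<close>
  have "inj_on codes (Pow ?I)"
  proof (rule inj_onI)
    fix \<tau> \<tau>' assume \<tau>: "\<tau> \<in> Pow ?I" "\<tau>' \<in> Pow ?I" "codes \<tau> = codes \<tau>'"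
    have "(i, j) \<in> \<tau> \<longleftrightarrow> (i, j) \<in> \<tau>'" if ij: "i < n" "j < n" for i j
    proof -
      have sij: "s i j \<in> ?H" "s i j ` An \<subseteq> F" using s ij by auto
      have "emb_act An (g \<tau>) (s i j) \<in> S \<longleftrightarrow> emb_act An (g \<tau>') (s i j) \<in> S" if "S \<in> \<M>" for S
      proof -
        have "code S \<tau> = code S \<tau>'" using fun_cong[OF \<tau>(3), of S] that by (simp add: codes_def)
        then show ?thesis using code_iff[OF that sij] by simp
      qed
      then have "emb_act An (g \<tau>) (s i j) \<in> ?T \<longleftrightarrow> emb_act An (g \<tau>') (s i j) \<in> ?T"
        using determined emb_act_in_Emb[OF sij(1) g] by blast
      then show ?thesis using pattern[OF ij] \<tau>(1,2) by simp
    qed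
    then show "\<tau> = \<tau>'" using \<tau>(1,2) by auto
  qed
  moreover have "codes ` Pow ?I \<subseteq> \<M> \<rightarrow>\<^sub>E order_codes An F"
    using code by (auto simp: codes_def)
  moreover have "finite (\<M> \<rightarrow>\<^sub>E order_codes An F)"
    by (rule finite_PiE[OF \<M>(1) finite_order_codes[OF fin(1) F(1)]])
  ultimately have "card (Pow ?I) \<le> card (\<M> \<rightarrow>\<^sub>E order_codes An F)" by (rule card_inj_on_le)
  then have "2 ^ (n * n) \<le> ((card An * n) ^ (card An * n) * 2 ^ (card An ^ card An)) ^ card \<M>"
    using \<M>(1) An F(1,3) by (simp add: card_Pow card_cartesian_product card_PiE card_order_codes)
  with few show False by simp
qed

end
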